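(* Let $s\geqslant 1$ be arbitrary. The moment positivity problem, i.e. deciding for a given input matrix $A$ whether $\mathrm{tr}(A^n)\geqslant 0$ for all $n\geqslant 0$, is decidable in each of the following cases: (i) the set of instances is the set of matrices $A\in\mathrm{Mat}_s(\mathbb{Q})$ with a unique dominant eigenvalue; (ii) the set of instances is the set of matrices $A\in\mathrm{Mat}_s(\mathbb{Q})$ with only real eigenvalues.
   Context: $\mathrm{Mat}_s(\mathbb{Q})$ is the set of $s\times s$ matrices with rational entries. A matrix has a unique dominant eigenvalue if exactly one complex number among its distinct eigenvalues has the largest absolute value; this eigenvalue may have multiplicity greater than $1$. In (ii), "only real eigenvalues" means that all complex eigenvalues are real. A decision problem with a given set of instances is decidable if there is an algorithm that, on input any instance from this set, stops after finite time with the correct yes/no answer. *)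

theory Defs
  imports
    "Jordan_Normal_Form.Spectral_Radius"
    "HOL-Library.Nat_Bijection"
begin

text \<open>Algorithms are Kleene's partial recursive functions, given as syntactic objects with a
  big-step semantics: \<open>rec_eval f xs y\<close> means that the computation of \<open>f\<close> on the argument
  tuple \<open>xs\<close> halts with value \<open>y\<close>. Arities are not part of the syntax; a term applied to
  a tuple of unsuitable length may simply have no value.\<close>

datatype recf =
    Zero
  | Succ
  | Proj nat
  | Comp recf "recf list"
  | PrimRec recf recf
  | Mu recf

inductive rec_eval :: "recf \<Rightarrow> nat list \<Rightarrow> nat \<Rightarrow> bool" where
  zero: "rec_eval Zero xs 0"
| succ: "rec_eval Succ [x] (Suc x)"
| proj: "i < length xs \<Longrightarrow> rec_eval (Proj i) xs (xs ! i)"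
| comp: "list_all2 (\<lambda>g y. rec_eval g xs y) gs ys \<Longrightarrow> rec_eval f ys z
    \<Longrightarrow> rec_eval (Comp f gs) xs z"
| prim_0: "rec_eval f xs y \<Longrightarrow> rec_eval (PrimRec f g) (0 # xs) y"
| prim_Suc: "rec_eval (PrimRec f g) (n # xs) r \<Longrightarrow> rec_eval g (n # r # xs) y
    \<Longrightarrow> rec_eval (PrimRec f g) (Suc n # xs) y"
| mu: "rec_eval f (n # xs) 0 \<Longrightarrow> (\<And>i. i < n \<Longrightarrow> \<exists>y. 0 < y \<and> rec_eval f (i # xs) y)
    \<Longrightarrow> rec_eval (Mu f) xs n"

inductive_cases rec_eval_ZeroE: "rec_eval Zero xs y"
inductive_cases rec_eval_SuccE: "rec_eval Succ xs y"
inductive_cases rec_eval_ProjE: "rec_eval (Proj i) xs y"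
inductive_cases rec_eval_CompE: "rec_eval (Comp f gs) xs y"
inductive_cases rec_eval_PrimRec0E: "rec_eval (PrimRec f g) (0 # xs) y"
inductive_cases rec_eval_PrimRecSucE: "rec_eval (PrimRec f g) (Suc n # xs) y"
inductive_cases rec_eval_MuE: "rec_eval (Mu f) xs y"

text \<open>A term computes at most one value on each input, so the answer 1 excludes the answer 0.\<close>

lemma rec_eval_unique: "rec_eval f xs y \<Longrightarrow> rec_eval f xs z \<Longrightarrow> y = z"
proof (induction arbitrary: z rule: rec_eval.induct)
  case (zero xs)
  from zero.prems show ?case by (rule rec_eval_ZeroE) simp
next
  case (succ x)
  from succ.prems show ?case by (rule rec_eval_SuccE) simp
next
  case (proj i xs)
  from proj.prems show ?case by (rule rec_eval_ProjE) simp
next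
  case (comp xs gs ys f y)
  from comp.prems obtain ys' where
    ys': "list_all2 (\<lambda>g y. rec_eval g xs y) gs ys'" "rec_eval f ys' z"
    by (rule rec_eval_CompE)
  have "ys = ys'"
  proof (rule nth_equalityI)
    have "length gs = length ys" using comp.IH(1) by (rule list_all2_lengthD)
    moreover have "length gs = length ys'" using ys'(1) by (rule list_all2_lengthD)
    ultimately show "length ys = length ys'" by simp
    fix i assume "i < length ys"
    with \<open>length gs = length ys\<close> have i: "i < length gs" by simp
    show "ys ! i = ys' ! i"
      using list_all2_nthD[OF comp.IH(1) i] list_all2_nthD[OF ys'(1) i] by blast
  qed
  with ys'(2) comp.IH(2) show ?case by blast
next
  case (prim_0 f xs y g)
  from prim_0.prems have "rec_eval f xs z" by (rule rec_eval_PrimRec0E)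
  then show ?case by (rule prim_0.IH)
next
  case (prim_Suc f g n xs r y)
  from prim_Suc.prems obtain r' where
    r': "rec_eval (PrimRec f g) (n # xs) r'" "rec_eval g (n # r' # xs) z"
    by (rule rec_eval_PrimRecSucE)
  from prim_Suc.IH(1)[OF r'(1)] r'(2) have "rec_eval g (n # r # xs) z" by simp
  then show ?case by (rule prim_Suc.IH(2))
next
  case (mu f n xs)
  from mu.prems have
    z0: "rec_eval f (z # xs) 0" and
    z: "\<And>i. i < z \<Longrightarrow> \<exists>y. 0 < y \<and> rec_eval f (i # xs) y"
    by (auto elim: rec_eval_MuE)
  show ?case
  proof (cases n z rule: linorder_cases)
    case less
    then obtain y where "0 < y" "rec_eval f (n # xs) y" using z by blast
    with mu.IH(1) show ?thesis by force
  next
    case greater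
    then obtain y where "0 < y" "\<forall>y'. rec_eval f (z # xs) y' \<longrightarrow> y = y'"
      using mu.IH(2) by blast
    with z0 show ?thesis by force
  qed
qed

text \<open>The set \<open>I\<close> of instances is a promise: nothing is required of the algorithm, not even
  termination, on inputs that do not encode an element of \<open>I\<close>.\<close>

definition decidable_on :: "('a \<Rightarrow> nat) \<Rightarrow> 'a set \<Rightarrow> ('a \<Rightarrow> bool) \<Rightarrow> bool" where
  "decidable_on enc I P \<longleftrightarrow>
     (\<exists>f. \<forall>x\<in>I. rec_eval f [enc x] (if P x then 1 else 0))"

text \<open>A rational number is encoded by its numerator and positive denominator in lowest terms,
  a matrix by the list of its rows.\<close>

definition rat_encode :: "rat \<Rightarrow> nat" where
  "rat_encode q = (case quotient_of q of (a, b) \<Rightarrow> prod_encode (int_encode a, nat b))"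

definition mat_encode :: "rat mat \<Rightarrow> nat" where
  "mat_encode A = list_encode (map (\<lambda>r. list_encode (map rat_encode r)) (mat_to_list A))"

definition mat_trace :: "'a :: comm_monoid_add mat \<Rightarrow> 'a" where
  "mat_trace A = (\<Sum>i<dim_row A. A $$ (i, i))"

definition complex_spectrum :: "rat mat \<Rightarrow> complex set" where
  "complex_spectrum A = spectrum (map_mat of_rat A)"

definition unique_dominant_eigenvalue :: "rat mat \<Rightarrow> bool" where
  "unique_dominant_eigenvalue A \<longleftrightarrow>
     (\<exists>!l. l \<in> complex_spectrum A \<and> (\<forall>m\<in>complex_spectrum A. norm m \<le> norm l))"

definition only_real_eigenvalues :: "rat mat \<Rightarrow> bool" where
  "only_real_eigenvalues A \<longleftrightarrow> complex_spectrum A \<subseteq> \<real>"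

definition moments_nonneg :: "rat mat \<Rightarrow> bool" where
  "moments_nonneg A \<longleftrightarrow> (\<forall>n. 0 \<le> mat_trace (A ^\<^sub>m n))"

end

theory Submission
  imports Defs
begin

text \<open>The procedure computes finitely many moments and answers yes if none of them is negative.
  What makes this correct is an explicit, computable bound after which the signs of the moments are
  settled.

  Clearing denominators changes no sign, so let the matrix have integer entries, with absolute
  values adding up to less than \<open>H\<close>. The trace of the \<open>n\<close>-th power is the sum of the \<open>n\<close>-th powers
  of the eigenvalues (\<open>mat_trace_pow_eq_power_sum\<close>). If one real eigenvalue is dominant, then its
  powers eventually outweigh all others, and the sign of the trace has period two in \<open>n\<close>. If all
  eigenvalues are real, then even moments are nonnegative, and in odd moments opposite eigenvalues
  cancel as far as their multiplicities allow; the largest modulus that survives is dominant, so the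
  sign has period two again (\<open>power_sum_sign\<close> and its two consequences).

  How soon the dominant term wins depends on how close two different moduli of eigenvalues can be.
  The difference \<open>a * cnj a - b * cnj b\<close> for eigenvalues \<open>a\<close>, \<open>b\<close> is an eigenvalue of an integer
  matrix of size \<open>s ^ 4\<close> that is built from Kronecker products. The product of the nonzero
  eigenvalues of an integer matrix is a nonzero integer, so none of them is very small, and this
  yields \<open>eigenvalue_modulus_gap\<close>. The resulting bound on \<open>n\<close> is a polynomial in \<open>H\<close> for fixed \<open>s\<close>.
  Past it, a nonnegative moment implies a nonnegative moment two steps later (\<open>moment_step\<close>), so
  it is enough to test the moments up to two steps past the bound (\<open>moments_nonneg_iff_bounded\<close>).

  It remains to see that the bound and the moments are recursive functions of the code of the
  matrix. For this, closure properties of the total computable functions are collected, including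
  the decoding of pairs, lists and integers and the arithmetic of integers.\<close>

section \<open>Total computable functions\<close>

text \<open>Arities are not part of the syntax of terms, so the number of arguments is fixed here.
  Totality is built in: every function that the decision procedure uses is total, even on numbers
  that encode no matrix, so no domain of definition has to be carried along.\<close>

definition computable :: "nat \<Rightarrow> (nat list \<Rightarrow> nat) \<Rightarrow> bool" where
  "computable k F \<longleftrightarrow> (\<exists>f. \<forall>xs. length xs = k \<longrightarrow> rec_eval f xs (F xs))"

lemma computableI: "(\<And>xs. length xs = k \<Longrightarrow> rec_eval f xs (F xs)) \<Longrightarrow> computable k F"
  by (auto simp: computable_def)

lemma computable_cong:
  assumes "computable k F" "\<And>xs. length xs = k \<Longrightarrow> F xs = G xs"
  shows "computable k G"
  using assms by (auto simp: computable_def)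

lemma computable_proj: "i < k \<Longrightarrow> computable k (\<lambda>xs. xs ! i)"
  by (rule computableI[of _ "Proj i"]) (auto intro: rec_eval.proj)

lemma computable_comp:
  assumes "computable (length Fs) G" "\<And>F. F \<in> set Fs \<Longrightarrow> computable k F"
  shows "computable k (\<lambda>xs. G (map (\<lambda>F. F xs) Fs))"
proof -
  obtain g where g: "\<And>ys. length ys = length Fs \<Longrightarrow> rec_eval g ys (G ys)"
    using assms(1) by (auto simp: computable_def)
  have "\<exists>f. \<forall>xs. length xs = k \<longrightarrow> rec_eval f xs (F xs)" if "F \<in> set Fs" for F
    using assms(2)[OF that] by (auto simp: computable_def)
  then obtain h where h: "\<And>F xs. F \<in> set Fs \<Longrightarrow> length xs = k \<Longrightarrow> rec_eval (h F) xs (F xs)"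
    by metis
  show ?thesis
  proof (rule computableI)
    fix xs :: "nat list" assume "length xs = k"
    then have "list_all2 (\<lambda>f y. rec_eval f xs y) (map h Fs) (map (\<lambda>F. F xs) Fs)"
      using h by (auto simp: list_all2_conv_all_nth)
    then show "rec_eval (Comp g (map h Fs)) xs (G (map (\<lambda>F. F xs) Fs))"
      by (rule rec_eval.comp) (rule g, simp)
  qed
qed

lemma computable_Suc:
  assumes "computable k F"
  shows "computable k (\<lambda>xs. Suc (F xs))"
proof -
  have "computable 1 (\<lambda>ys. Suc (ys ! 0))"
    by (rule computableI[of _ Succ]) (auto simp: length_Suc_conv intro: rec_eval.succ)
  from computable_comp[of "[F]" "\<lambda>ys. Suc (ys ! 0)" k] this assms show ?thesis by simp
qed

lemma computable_const: "computable k (\<lambda>xs. c)"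
proof (induction c)
  case 0
  show ?case by (rule computableI) (rule rec_eval.zero)
qed (rule computable_Suc)

text \<open>The step function of a primitive recursion sees the counter and the previous value in front
  of the parameters. This rule lets a function of the parameters alone be used there.\<close>

lemma computable_drop:
  assumes "computable k F" "m = n + k"
  shows "computable m (\<lambda>xs. F (drop n xs))"
proof -
  have "computable m (\<lambda>xs. F (map (\<lambda>G. G xs) (map (\<lambda>i xs. xs ! (n + i)) [0..<k])))"
    by (rule computable_comp) (use assms in \<open>auto intro: computable_proj\<close>)
  then show ?thesis
    by (rule computable_cong)
      (auto simp: assms(2) comp_def intro!: arg_cong[of _ _ F] nth_equalityI)
qed

lemma computable_rec:
  assumes F: "computable k F" and G: "computable (Suc (Suc k)) G" and N: "computable k N"
  shows "computable k (\<lambda>xs. rec_nat (F xs) (\<lambda>n r. G (n # r # xs)) (N xs))"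
proof -
  obtain f g where f: "\<And>xs. length xs = k \<Longrightarrow> rec_eval f xs (F xs)"
    and g: "\<And>ys. length ys = Suc (Suc k) \<Longrightarrow> rec_eval g ys (G ys)"
    using F G by (auto simp: computable_def)
  let ?R = "\<lambda>xs n. rec_nat (F xs) (\<lambda>n r. G (n # r # xs)) n"
  have ev: "rec_eval (PrimRec f g) (n # xs) (?R xs n)" if "length xs = k" for xs n
    by (induction n) (auto intro!: rec_eval.prim_0 f rec_eval.prim_Suc g simp: that)
  \<comment> \<open>The recursion variable comes first in the argument tuple; composing with all projections
    allows the number of steps to depend on the same parameters as the start value.\<close>
  have R: "computable (Suc k) (\<lambda>ys. ?R (tl ys) (hd ys))"
    by (rule computableI[of _ "PrimRec f g"]) (auto simp: length_Suc_conv ev)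
  have "computable k (\<lambda>xs. (\<lambda>ys. ?R (tl ys) (hd ys))
      (map (\<lambda>F. F xs) (N # map (\<lambda>i xs. xs ! i) [0..<k])))"
    by (rule computable_comp) (use R N in \<open>auto intro: computable_proj\<close>)
  moreover have "map ((!) xs) [0..<k] = xs" if "length xs = k" for xs :: "nat list"
    using that by (auto intro!: nth_equalityI)
  ultimately show ?thesis
    by (elim computable_cong) (simp add: comp_def)
qed

lemma computable_Least:
  assumes F: "computable (Suc k) F" and ex: "\<And>xs. length xs = k \<Longrightarrow> \<exists>n. F (n # xs) = 0"
  shows "computable k (\<lambda>xs. LEAST n. F (n # xs) = 0)"
proof -
  obtain f where f: "\<And>xs. length xs = Suc k \<Longrightarrow> rec_eval f xs (F xs)"
    using F by (auto simp: computable_def)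
  show ?thesis
  proof (rule computableI)
    fix xs :: "nat list" assume xs: "length xs = k"
    let ?n = "LEAST n. F (n # xs) = 0"
    have 0: "F (?n # xs) = 0" using ex[OF xs] by (rule LeastI_ex)
    show "rec_eval (Mu f) xs ?n"
    proof (rule rec_eval.mu)
      show "rec_eval f (?n # xs) 0" using f[of "?n # xs"] xs 0 by simp
      show "\<exists>y>0. rec_eval f (i # xs) y" if "i < ?n" for i
        using not_less_Least[OF that] f[of "i # xs"] xs by auto
    qed
  qed
qed

lemma computable_add:
  assumes "computable k F" "computable k G"
  shows "computable k (\<lambda>xs. F xs + G xs)"
proof -
  have "computable k (\<lambda>xs. rec_nat (F xs) (\<lambda>n r. Suc ((n # r # xs) ! 1)) (G xs))"
    by (rule computable_rec) (auto intro: assms computable_Suc computable_proj)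
  moreover have "rec_nat a (\<lambda>n r. Suc ((n # r # xs) ! 1)) b = a + b" for a b xs
    by (induction b) auto
  ultimately show ?thesis by simp
qed

lemma computable_mult:
  assumes "computable k F" "computable k G"
  shows "computable k (\<lambda>xs. F xs * G xs)"
proof -
  have "computable k (\<lambda>xs. rec_nat 0 (\<lambda>n r. (n # r # xs) ! 1 + F (drop 2 (n # r # xs))) (G xs))"
    by (rule computable_rec)
      (intro computable_const assms computable_add computable_proj computable_drop[OF assms(1)]; simp)+
  moreover have "rec_nat 0 (\<lambda>n r. (n # r # xs) ! 1 + F (drop 2 (n # r # xs))) b = F xs * b" for b xs
    by (induction b) auto
  ultimately show ?thesis by simp
qed

lemma computable_diff:
  assumes "computable k F" "computable k G"
  shows "computable k (\<lambda>xs. F xs - G xs)"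
proof -
  have pred: "computable k (\<lambda>xs. F xs - 1)" if "computable k F" for k F
  proof -
    have "computable k (\<lambda>xs. rec_nat 0 (\<lambda>n r. (n # r # xs) ! 0) (F xs))"
      by (rule computable_rec) (auto intro: that computable_proj computable_const)
    moreover have "rec_nat 0 (\<lambda>n r. (n # r # xs) ! 0) b = b - 1" for b xs
      by (cases b) auto
    ultimately show ?thesis by simp
  qed
  have "computable k (\<lambda>xs. rec_nat (F xs) (\<lambda>n r. (n # r # xs) ! 1 - 1) (G xs))"
    by (rule computable_rec) (intro assms pred computable_proj; simp)+
  moreover have "rec_nat a (\<lambda>n r. (n # r # xs) ! 1 - 1) b = a - b" for a b xs
    by (induction b) auto
  ultimately show ?thesis by simp
qed

lemmas computable_arith =
  computable_const computable_proj computable_Suc computable_add computable_mult computable_diff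

lemma computable_power: "computable k F \<Longrightarrow> computable k (\<lambda>xs. F xs ^ c)"
  by (induction c) (auto intro: computable_arith)

lemma computable_sum:
  assumes "\<And>i. i \<in> I \<Longrightarrow> computable k (F i)"
  shows "computable k (\<lambda>xs. \<Sum>i\<in>I. F i xs)"
  using assms by (induction I rule: infinite_finite_induct) (auto intro: computable_arith)

text \<open>Halving, like the decoding of pairs below, inverts a monotone function, and minimization
  computes such inverses without any recursion.\<close>

lemma computable_div2:
  assumes "computable k F"
  shows "computable k (\<lambda>xs. F xs div 2)"
proof -
  have "computable k (\<lambda>xs. LEAST n. (\<lambda>ys. Suc (F (drop 1 ys)) - (2 * (ys ! 0) + 2)) (n # xs) = 0)"
  proof (rule computable_Least)
    show "computable (Suc k) (\<lambda>ys. Suc (F (drop 1 ys)) - (2 * (ys ! 0) + 2))"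
      by (intro computable_arith computable_drop[OF assms]) auto
    show "\<exists>n. Suc (F (drop 1 (n # xs))) - (2 * (n # xs) ! 0 + 2) = 0" for xs
      by (rule exI[of _ "F xs"]) simp
  qed
  moreover have "(LEAST n. Suc (F xs) - (2 * n + 2) = 0) = F xs div 2" for xs
    by (rule Least_equality) auto
  ultimately show ?thesis by simp
qed

lemma computable_mod2: "computable k F \<Longrightarrow> computable k (\<lambda>xs. F xs mod 2)"
  unfolding modulo_nat_def by (intro computable_arith computable_div2)

section \<open>Codes of pairs and lists\<close>

lemma computable_triangle:
  assumes "computable k F"
  shows "computable k (\<lambda>xs. triangle (F xs))"
  unfolding triangle_def by (intro computable_div2 computable_arith assms)

lemma computable_prod_encode:
  assumes "computable k F" "computable k G"
  shows "computable k (\<lambda>xs. prod_encode (F xs, G xs))"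
  unfolding prod_encode_def by (auto intro!: computable_arith computable_triangle assms)

text \<open>The Cantor pairing sends \<open>(a, b)\<close> to \<open>triangle (a + b) + a\<close>, so \<open>a + b\<close> is the
  largest \<open>w\<close> with \<open>triangle w\<close> at most the code. Minimization finds this \<open>w\<close>, and two
  subtractions then recover \<open>a\<close> and \<open>b\<close>.\<close>

lemma computable_prod_decode:
  assumes "computable k F"
  shows "computable k (\<lambda>xs. fst (prod_decode (F xs)))"
    and "computable k (\<lambda>xs. snd (prod_decode (F xs)))"
proof -
  let ?w = "\<lambda>z. LEAST n. Suc z - triangle (Suc n) = 0"
  have w: "computable k (\<lambda>xs. ?w (F xs))"
  proof -
    have "computable k (\<lambda>xs. LEAST n. (\<lambda>ys. Suc (F (drop 1 ys)) - triangle (Suc (ys ! 0))) (n # xs) = 0)"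
    proof (rule computable_Least)
      show "computable (Suc k) (\<lambda>ys. Suc (F (drop 1 ys)) - triangle (Suc (ys ! 0)))"
        by (intro computable_arith computable_triangle computable_drop[OF assms]) auto
      show "\<exists>n. Suc (F (drop 1 (n # xs))) - triangle (Suc ((n # xs) ! 0)) = 0" for xs
        by (rule exI[of _ "F xs"]) simp
    qed
    then show ?thesis by simp
  qed
  have mono: "triangle m \<le> triangle n" if "m \<le> n" for m n
    using that by (induction rule: dec_induct) auto
  have w_eq: "?w (prod_encode (a, b)) = a + b" for a b
  proof (rule Least_equality)
    show "Suc (prod_encode (a, b)) - triangle (Suc (a + b)) = 0" by (simp add: prod_encode_def)
    show "a + b \<le> n" if "Suc (prod_encode (a, b)) - triangle (Suc n) = 0" for n
    proof (rule ccontr)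
      assume "\<not> a + b \<le> n"
      then have "triangle (Suc n) \<le> triangle (a + b)" by (intro mono) simp
      with that show False by (simp add: prod_encode_def)
    qed
  qed
  have fs: "fst (prod_decode z) = z - triangle (?w z)" "snd (prod_decode z) = ?w z - (z - triangle (?w z))" for z
  proof -
    obtain a b where z: "z = prod_encode (a, b)"
      by (metis prod_decode_inverse surj_pair)
    have "prod_encode (a, b) - triangle (a + b) = a" by (simp add: prod_encode_def)
    then show "fst (prod_decode z) = z - triangle (?w z)"
      and "snd (prod_decode z) = ?w z - (z - triangle (?w z))"
      unfolding z w_eq by simp_all
  qed
  show "computable k (\<lambda>xs. fst (prod_decode (F xs)))" "computable k (\<lambda>xs. snd (prod_decode (F xs)))"
    unfolding fs by (intro computable_arith computable_triangle w assms)+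
qed

text \<open>A nonempty list is encoded by the successor of the code of the pair of its head and tail.\<close>

definition code_hd :: "nat \<Rightarrow> nat" where
  "code_hd c = fst (prod_decode (c - 1))"

definition code_tl :: "nat \<Rightarrow> nat" where
  "code_tl c = snd (prod_decode (c - 1))"

definition code_nth :: "nat \<Rightarrow> nat \<Rightarrow> nat" where
  "code_nth c i = code_hd ((code_tl ^^ i) c)"

lemma code_nth_list_encode: "i < length l \<Longrightarrow> code_nth (list_encode l) i = l ! i"
proof (induction l arbitrary: i)
  case (Cons x l)
  then show ?case
    by (cases i) (simp_all add: code_nth_def code_hd_def code_tl_def funpow_Suc_right del: funpow.simps)
qed simp

lemma computable_code_nth:
  assumes "computable k F"
  shows "computable k (\<lambda>xs. code_nth (F xs) i)"
proof -
  have "computable k (\<lambda>xs. (code_tl ^^ i) (F xs))"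
    by (induction i) (auto simp: code_tl_def intro!: computable_prod_decode computable_arith assms)
  then show ?thesis
    unfolding code_nth_def code_hd_def by (intro computable_prod_decode computable_arith)
qed

lemma computable_list_encode:
  "(\<And>F. F \<in> set Fs \<Longrightarrow> computable k F) \<Longrightarrow> computable k (\<lambda>xs. list_encode (map (\<lambda>F. F xs) Fs))"
  by (induction Fs) (auto intro!: computable_arith computable_prod_encode)

definition code_entry :: "nat \<Rightarrow> nat \<Rightarrow> nat \<Rightarrow> nat" where
  "code_entry c i j = code_nth (code_nth c i) j"

definition encode_square :: "nat \<Rightarrow> (nat \<Rightarrow> nat \<Rightarrow> nat) \<Rightarrow> nat" where
  "encode_square s f = list_encode (map (\<lambda>i. list_encode (map (f i) [0..<s])) [0..<s])"

lemma code_entry_encode_square: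
  "i < s \<Longrightarrow> j < s \<Longrightarrow> code_entry (encode_square s f) i j = f i j"
  by (simp add: code_entry_def encode_square_def code_nth_list_encode)

lemma computable_code_entry: "computable k F \<Longrightarrow> computable k (\<lambda>xs. code_entry (F xs) i j)"
  unfolding code_entry_def by (intro computable_code_nth)

lemma computable_encode_square:
  assumes "\<And>i j. i < s \<Longrightarrow> j < s \<Longrightarrow> computable k (F i j)"
  shows "computable k (\<lambda>xs. encode_square s (\<lambda>i j. F i j xs))"
proof -
  have "computable k (\<lambda>xs. list_encode (map (\<lambda>j. F i j xs) [0..<s]))" if "i < s" for i
  proof -
    have "computable k (\<lambda>xs. list_encode (map (\<lambda>F. F xs) (map (F i) [0..<s])))"
      by (rule computable_list_encode) (use assms that in auto)
    then show ?thesis by (simp add: comp_def)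
  qed
  then have "computable k (\<lambda>xs. list_encode (map (\<lambda>F. F xs)
      (map (\<lambda>i xs. list_encode (map (\<lambda>j. F i j xs) [0..<s])) [0..<s])))"
    by (intro computable_list_encode) auto
  then show ?thesis by (simp add: encode_square_def comp_def)
qed

section \<open>Integer-valued computable functions\<close>

definition computable_int :: "nat \<Rightarrow> (nat list \<Rightarrow> int) \<Rightarrow> bool" where
  "computable_int k F \<longleftrightarrow> computable k (\<lambda>xs. int_encode (F xs))"

text \<open>Codes of integers interleave the two signs, which makes them awkward for arithmetic. Being
  computable is the same as being a difference of two computable functions with natural values, and
  the closure under sums and products is clear from the latter form.\<close>

lemma computable_int_diff_of_nat:
  assumes "computable k P" "computable k N"
  shows "computable_int k (\<lambda>xs. int (P xs) - int (N xs))"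
proof -
  have "int_encode (int p - int n) = 2 * (p - n) + (2 * (n - p) - 1)" for p n
    by (auto simp: int_encode_def sum_encode_def)
  then show ?thesis
    unfolding computable_int_def by (simp only:) (intro computable_arith assms)
qed

text \<open>Even codes are those of nonnegative integers, odd codes those of negative ones.\<close>

lemma nat_int_encode:
  "nat z = (1 - int_encode z mod 2) * (int_encode z div 2)"
  "nat (- z) = int_encode z mod 2 * Suc (int_encode z div 2)"
  by (auto simp: int_encode_def sum_encode_def)

lemma computable_int_nat_parts:
  assumes "computable_int k F"
  shows "computable k (\<lambda>xs. nat (F xs))" "computable k (\<lambda>xs. nat (- F xs))"
  using assms unfolding computable_int_def nat_int_encode(1)[of "F _"] nat_int_encode(2)
  by (intro computable_arith computable_div2 computable_mod2; simp)+

lemma computable_intE: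
  assumes "computable_int k F"
  obtains P N where "computable k P" "computable k N" "F = (\<lambda>xs. int (P xs) - int (N xs))"
  using computable_int_nat_parts[OF assms] by (rule that) auto

lemma computable_int_decode: "computable k F \<Longrightarrow> computable_int k (\<lambda>xs. int_decode (F xs))"
  by (simp add: computable_int_def)

lemma computable_int_of_nat: "computable k F \<Longrightarrow> computable_int k (\<lambda>xs. int (F xs))"
  using computable_int_diff_of_nat[of k F "\<lambda>_. 0"] by (simp add: computable_const)

lemma computable_int_add:
  assumes "computable_int k F" "computable_int k G"
  shows "computable_int k (\<lambda>xs. F xs + G xs)"
proof -
  obtain P N where F: "computable k P" "computable k N" "F = (\<lambda>xs. int (P xs) - int (N xs))"
    using assms(1) by (rule computable_intE)
  obtain P' N' where G: "computable k P'" "computable k N'" "G = (\<lambda>xs. int (P' xs) - int (N' xs))"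
    using assms(2) by (rule computable_intE)
  have "computable_int k (\<lambda>xs. int (P xs + P' xs) - int (N xs + N' xs))"
    by (intro computable_int_diff_of_nat computable_arith F G)
  then show ?thesis by (simp add: F(3) G(3) algebra_simps)
qed

lemma computable_int_mult:
  assumes "computable_int k F" "computable_int k G"
  shows "computable_int k (\<lambda>xs. F xs * G xs)"
proof -
  obtain P N where F: "computable k P" "computable k N" "F = (\<lambda>xs. int (P xs) - int (N xs))"
    using assms(1) by (rule computable_intE)
  obtain P' N' where G: "computable k P'" "computable k N'" "G = (\<lambda>xs. int (P' xs) - int (N' xs))"
    using assms(2) by (rule computable_intE)
  have "computable_int k (\<lambda>xs. int (P xs * P' xs + N xs * N' xs) - int (P xs * N' xs + N xs * P' xs))"
    by (intro computable_int_diff_of_nat computable_arith F G)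
  then show ?thesis by (simp add: F(3) G(3) algebra_simps)
qed

lemma computable_int_sum:
  assumes "\<And>i. i \<in> I \<Longrightarrow> computable_int k (F i)"
  shows "computable_int k (\<lambda>xs. \<Sum>i\<in>I. F i xs)"
  using assms
proof (induction I rule: infinite_finite_induct)
  case (insert i I)
  then show ?case by (simp add: computable_int_add)
qed (use computable_int_of_nat[OF computable_const, of k 0] in simp_all)

lemma computable_int_prod:
  assumes "\<And>i. i \<in> I \<Longrightarrow> computable_int k (F i)"
  shows "computable_int k (\<lambda>xs. \<Prod>i\<in>I. F i xs)"
  using assms
proof (induction I rule: infinite_finite_induct)
  case (insert i I)
  then show ?case by (simp add: computable_int_mult)
qed (use computable_int_of_nat[OF computable_const, of k 1] in simp_all)

text \<open>The truth value of a bounded universal quantifier is a product, which primitive recursion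
  accumulates. The factor \<open>1 - nat (- z)\<close>, with truncated subtraction, is the truth value of
  \<open>0 \<le> z\<close>.\<close>

lemma computable_bounded_nonneg:
  assumes N: "computable k N" and F: "computable_int (Suc k) (\<lambda>ys. F (hd ys) (tl ys))"
  shows "computable k (\<lambda>xs. if \<forall>n<N xs. 0 \<le> F n xs then 1 else 0)"
proof -
  let ?G = "\<lambda>ys. ys ! 1 * (1 - nat (- F (hd ys) (drop 2 ys)))"
  have "computable (Suc (Suc k)) (\<lambda>ys. (\<lambda>ys. nat (- F (hd ys) (tl ys)))
     (map (\<lambda>G. G ys) ((\<lambda>ys. ys ! 0) # map (\<lambda>i ys. ys ! (2 + i)) [0..<k])))"
    by (rule computable_comp) (use computable_int_nat_parts(2)[OF F] in \<open>auto intro: computable_proj\<close>)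
  then have "computable (Suc (Suc k)) (\<lambda>ys. nat (- F (hd ys) (drop 2 ys)))"
  proof (rule computable_cong)
    fix ys :: "nat list" assume ys: "length ys = Suc (Suc k)"
    then have "map (\<lambda>G. G ys) (map (\<lambda>i ys. ys ! (2 + i)) [0..<k]) = drop 2 ys"
      by (auto intro!: nth_equalityI)
    with ys show "nat (- F (hd (map (\<lambda>G. G ys) ((\<lambda>ys. ys ! 0) # map (\<lambda>i ys. ys ! (2 + i)) [0..<k])))
        (tl (map (\<lambda>G. G ys) ((\<lambda>ys. ys ! 0) # map (\<lambda>i ys. ys ! (2 + i)) [0..<k]))))
        = nat (- F (hd ys) (drop 2 ys))"
      by (cases ys) auto
  qed
  then have "computable (Suc (Suc k)) ?G"
    by (intro computable_arith) auto
  from computable_rec[OF computable_const[of k 1] this N]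
  have "computable k (\<lambda>xs. rec_nat 1 (\<lambda>n r. ?G (n # r # xs)) (N xs))" .
  moreover have "rec_nat 1 (\<lambda>n r. ?G (n # r # xs)) m = (if \<forall>n<m. 0 \<le> F n xs then 1 else 0)" for m xs
    by (induction m) (auto simp: less_Suc_eq)
  ultimately show ?thesis by simp
qed

section \<open>Traces of powers as power sums of eigenvalues\<close>

lemma mat_trace_mult_commute:
  fixes X Y :: "'a :: comm_semiring_0 mat"
  assumes "X \<in> carrier_mat n n" "Y \<in> carrier_mat n n"
  shows "mat_trace (X * Y) = mat_trace (Y * X)"
proof -
  have "mat_trace (X * Y) = (\<Sum>i<n. \<Sum>j<n. X $$ (i, j) * Y $$ (j, i))"
    using assms by (auto simp: mat_trace_def scalar_prod_def lessThan_atLeast0 intro!: sum.cong)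
  also have "\<dots> = (\<Sum>j<n. \<Sum>i<n. Y $$ (j, i) * X $$ (i, j))"
    by (subst sum.swap) (simp add: mult.commute)
  also have "\<dots> = mat_trace (Y * X)"
    using assms by (auto simp: mat_trace_def scalar_prod_def lessThan_atLeast0 intro!: sum.cong)
  finally show ?thesis .
qed

lemma upper_triangular_pow:
  fixes T :: "'a :: comm_semiring_1 mat"
  assumes T: "T \<in> carrier_mat n n" "upper_triangular T"
  shows "upper_triangular (T ^\<^sub>m k) \<and> (\<forall>i<n. (T ^\<^sub>m k) $$ (i, i) = (T $$ (i, i)) ^ k)"
proof (induction k)
  case (Suc k)
  let ?S = "T ^\<^sub>m k"
  have S: "?S \<in> carrier_mat n n" using T(1) by simp
  have S0: "?S $$ (i, j) = 0" if "j < i" "i < n" for i j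
    using Suc S that by (auto simp: upper_triangular_def)
  have T0: "T $$ (i, j) = 0" if "j < i" "i < n" for i j
    using T that by (auto simp: upper_triangular_def)
  have entry: "(?S * T) $$ (i, j) = (\<Sum>l<n. ?S $$ (i, l) * T $$ (l, j))" if "i < n" "j < n" for i j
    using S T(1) that by (auto simp: scalar_prod_def lessThan_atLeast0 intro!: sum.cong)
  have "(?S * T) $$ (i, j) = 0" if "j < i" "i < n" for i j
  proof -
    have "?S $$ (i, l) * T $$ (l, j) = 0" if "l < n" for l
      using S0[of l i] T0[of j l] that \<open>j < i\<close> \<open>i < n\<close> by (cases "l < i") auto
    then show ?thesis using that by (simp add: entry)
  qed
  moreover have "(?S * T) $$ (i, i) = (T $$ (i, i)) ^ Suc k" if "i < n" for i
  proof -
    have "?S $$ (i, l) * T $$ (l, i) = (if l = i then ?S $$ (i, i) * T $$ (i, i) else 0)" if "l < n" for l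
      using S0[of l i] T0[of i l] that \<open>i < n\<close> by (cases l i rule: linorder_cases) auto
    then have "(\<Sum>l<n. ?S $$ (i, l) * T $$ (l, i)) =
        (\<Sum>l<n. if l = i then ?S $$ (i, i) * T $$ (i, i) else 0)"
      by (intro sum.cong refl) simp
    also have "\<dots> = ?S $$ (i, i) * T $$ (i, i)"
      using that by simp
    finally have "(?S * T) $$ (i, i) = ?S $$ (i, i) * T $$ (i, i)"
      unfolding entry[OF that that] .
    with Suc that show ?thesis by (simp add: mult.commute)
  qed
  ultimately show ?case using S T(1) by (auto simp: upper_triangular_def)
qed (use T in \<open>auto simp: upper_triangular_def\<close>)

text \<open>By Schur triangularization the matrix is similar to an upper triangular one with the
  eigenvalues on the diagonal. Powers of the latter have the powers of the eigenvalues there, and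
  the trace is invariant under similarity.\<close>

lemma mat_trace_pow_eq_power_sum:
  fixes C :: "complex mat"
  assumes C: "C \<in> carrier_mat n n" and cp: "char_poly C = (\<Prod>a\<leftarrow>as. [:- a, 1:])"
    and len: "length as = n"
  shows "mat_trace (C ^\<^sub>m k) = (\<Sum>i<n. (as ! i) ^ k)"
proof -
  obtain T P Q where TPQ: "schur_decomposition C as = (T, P, Q)"
    by (cases "schur_decomposition C as") auto
  have sim: "similar_mat_wit C T P Q" and ut: "upper_triangular T" and diag: "diag_mat T = as"
    using schur_decomposition[OF C cp TPQ] by auto
  note w = similar_mat_witD2[OF C sim]
  have Tk: "T ^\<^sub>m k \<in> carrier_mat n n" using w(5) by simp
  have "mat_trace (C ^\<^sub>m k) = mat_trace (P * T ^\<^sub>m k * Q)"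
    by (simp add: similar_mat_wit_pow_id[OF sim])
  also have "\<dots> = mat_trace (Q * (P * T ^\<^sub>m k))"
    by (rule mat_trace_mult_commute[of _ n]) (use w Tk in auto)
  also have "Q * (P * T ^\<^sub>m k) = T ^\<^sub>m k"
    using assoc_mult_mat[OF w(7) w(6) Tk] left_mult_one_mat[OF Tk] w(2) by simp
  also have "mat_trace (T ^\<^sub>m k) = (\<Sum>i<n. (T $$ (i, i)) ^ k)"
    using upper_triangular_pow[OF w(5) ut, of k] w(5) by (simp add: mat_trace_def)
  also have "\<dots> = (\<Sum>i<n. (as ! i) ^ k)"
    using w(5) by (intro sum.cong) (auto simp: diag_mat_def simp flip: diag)
  finally show ?thesis .
qed

lemma spectrum_eq_set:
  fixes C :: "'a :: field mat"
  assumes "C \<in> carrier_mat n n" "char_poly C = (\<Prod>a\<leftarrow>as. [:- a, 1:])"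
  shows "spectrum C = set as"
  unfolding spectrum_root_char_poly[OF assms(1)] assms(2)
  by (auto simp: poly_prod_list prod_list_zero_iff)

section \<open>A gap between the moduli of eigenvalues of integer matrices\<close>

lemma eigenvalue_mat_iff:
  fixes f :: "nat \<Rightarrow> nat \<Rightarrow> 'a :: field"
  shows "eigenvalue (mat d d (\<lambda>(i, j). f i j)) k \<longleftrightarrow>
    (\<exists>w. (\<exists>i<d. w i \<noteq> 0) \<and> (\<forall>i<d. (\<Sum>j<d. f i j * w j) = k * w i))"
proof
  assume "eigenvalue (mat d d (\<lambda>(i, j). f i j)) k"
  then obtain v where v: "v \<in> carrier_vec d" "v \<noteq> 0\<^sub>v d"
    "mat d d (\<lambda>(i, j). f i j) *\<^sub>v v = k \<cdot>\<^sub>v v"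
    by (auto simp: eigenvalue_def eigenvector_def)
  have "(\<Sum>j<d. f i j * v $ j) = k * v $ i" if "i < d" for i
  proof -
    have "(\<Sum>j<d. f i j * v $ j) = (mat d d (\<lambda>(i, j). f i j) *\<^sub>v v) $ i"
      using v(1) that by (auto simp: scalar_prod_def lessThan_atLeast0 intro!: sum.cong)
    then show ?thesis using v(1) that by (simp add: v(3))
  qed
  moreover have "\<exists>i<d. v $ i \<noteq> 0" using v(1,2) by (auto intro: eq_vecI)
  ultimately show "\<exists>w. (\<exists>i<d. w i \<noteq> 0) \<and> (\<forall>i<d. (\<Sum>j<d. f i j * w j) = k * w i)"
    by (intro exI[of _ "\<lambda>i. v $ i"]) auto
next
  assume "\<exists>w. (\<exists>i<d. w i \<noteq> 0) \<and> (\<forall>i<d. (\<Sum>j<d. f i j * w j) = k * w i)"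
  then obtain w where w: "\<exists>i<d. w i \<noteq> 0" "\<And>i. i < d \<Longrightarrow> (\<Sum>j<d. f i j * w j) = k * w i" by auto
  have "vec d w \<noteq> 0\<^sub>v d"
    using w(1) by (metis index_vec index_zero_vec(1))
  moreover have "mat d d (\<lambda>(i, j). f i j) *\<^sub>v vec d w = k \<cdot>\<^sub>v vec d w"
  proof (rule eq_vecI)
    fix i assume "i < dim_vec (k \<cdot>\<^sub>v vec d w)"
    then have i: "i < d" by simp
    have "(mat d d (\<lambda>(i, j). f i j) *\<^sub>v vec d w) $ i = (\<Sum>j<d. f i j * w j)"
      using i by (auto simp: scalar_prod_def lessThan_atLeast0 intro!: sum.cong)
    then show "(mat d d (\<lambda>(i, j). f i j) *\<^sub>v vec d w) $ i = (k \<cdot>\<^sub>v vec d w) $ i"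
      using w(2)[OF i] i by simp
  qed simp
  ultimately show "eigenvalue (mat d d (\<lambda>(i, j). f i j)) k"
    unfolding eigenvalue_def eigenvector_def by (intro exI[of _ "vec d w"]) auto
qed

text \<open>The size of the matrix and a bound for its absolute row sums are recorded because together
  they bound a nonzero eigenvalue away from 0. The matrix is a function on indices rather than an
  element of a matrix type, which keeps Kronecker products simple.\<close>

definition integer_eigenvalue :: "nat \<Rightarrow> int \<Rightarrow> complex \<Rightarrow> bool" where
  "integer_eigenvalue d M k \<longleftrightarrow>
    (\<exists>T w. (\<exists>i<d. w i \<noteq> 0) \<and> (\<forall>i<d. (\<Sum>j<d. complex_of_int (T i j) * w j) = k * w i) \<and>
      (\<forall>i<d. (\<Sum>j<d. \<bar>T i j\<bar>) \<le> M))"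

text \<open>Compare both sides of the eigenvalue equation in a component where the eigenvector has the
  largest absolute value.\<close>

lemma norm_integer_eigenvalue_le:
  assumes "integer_eigenvalue d M k"
  shows "norm k \<le> M"
proof -
  obtain T w where w: "\<exists>i<d. w i \<noteq> 0" "\<And>i. i < d \<Longrightarrow> (\<Sum>j<d. complex_of_int (T i j) * w j) = k * w i"
    "\<And>i. i < d \<Longrightarrow> (\<Sum>j<d. \<bar>T i j\<bar>) \<le> M"
    using assms by (auto simp: integer_eigenvalue_def)
  define m where "m = Max ((\<lambda>i. norm (w i)) ` {..<d})"
  have ne: "(\<lambda>i. norm (w i)) ` {..<d} \<noteq> {}" using w(1) by auto
  have "m \<in> (\<lambda>i. norm (w i)) ` {..<d}" unfolding m_def by (intro Max_in ne) simp
  then obtain i where i: "i < d" "m = norm (w i)" by auto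
  have le: "norm (w j) \<le> m" if "j < d" for j unfolding m_def by (rule Max_ge) (use that in auto)
  have "m > 0"
  proof -
    obtain j where "j < d" "w j \<noteq> 0" using w(1) by auto
    then show ?thesis using le[of j] by (metis less_le_trans zero_less_norm_iff)
  qed
  have "norm k * m = norm (\<Sum>j<d. complex_of_int (T i j) * w j)"
    by (simp add: w(2)[OF i(1)] i(2) norm_mult)
  also have "\<dots> \<le> (\<Sum>j<d. real_of_int \<bar>T i j\<bar> * m)"
    by (intro sum_norm_le) (auto simp: norm_mult intro: mult_left_mono le)
  also have "\<dots> = real_of_int (\<Sum>j<d. \<bar>T i j\<bar>) * m"
    by (simp add: sum_distrib_right)
  also have "\<dots> \<le> real_of_int M * m"
    using w(3)[OF i(1)] \<open>m > 0\<close> by (intro mult_right_mono) (simp_all only: of_int_le_iff less_imp_le)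
  finally show ?thesis using \<open>m > 0\<close> by simp
qed

text \<open>The product of all nonzero eigenvalues is, up to sign, the lowest nonzero coefficient of the
  characteristic polynomial. This is a nonzero integer, so its absolute value is at least 1. As the
  other eigenvalues are at most \<open>M\<close>, none of the nonzero ones can be too small.\<close>

lemma integer_eigenvalue_lower_bound:
  assumes ev: "integer_eigenvalue d M k" and "k \<noteq> 0"
  shows "1 \<le> norm k * real_of_int M ^ d"
proof -
  obtain T w where w: "\<exists>i<d. w i \<noteq> 0" "\<And>i. i < d \<Longrightarrow> (\<Sum>j<d. complex_of_int (T i j) * w j) = k * w i"
    "\<And>i. i < d \<Longrightarrow> (\<Sum>j<d. \<bar>T i j\<bar>) \<le> M"
    using ev by (auto simp: integer_eigenvalue_def)
  define A where "A = mat d d (\<lambda>(i, j). T i j)"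
  define C where "C = mat d d (\<lambda>(i, j). complex_of_int (T i j))"
  have C: "C = map_mat of_int A" "C \<in> carrier_mat d d" "A \<in> carrier_mat d d"
    by (auto simp: C_def A_def)
  obtain as where as: "char_poly C = (\<Prod>a\<leftarrow>as. [:- a, 1:])" "length as = d"
    using char_poly_factorized[OF C(2)] by auto
  have bound: "norm a \<le> M" if "a \<in> set as" for a
  proof (rule norm_integer_eigenvalue_le)
    have "eigenvalue C a"
      using that spectrum_eq_set[OF C(2) as(1)] by (auto simp: spectrum_def)
    then show "integer_eigenvalue d M a"
      unfolding C_def eigenvalue_mat_iff integer_eigenvalue_def using w(3) by blast
  qed
  have k: "k \<in> set as"
  proof -
    have "eigenvalue C k" unfolding C_def eigenvalue_mat_iff using w by blast
    then show ?thesis using spectrum_eq_set[OF C(2) as(1)] by (auto simp: spectrum_def)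
  qed
  have M: "1 \<le> real_of_int M"
  proof -
    have "0 < norm k" using \<open>k \<noteq> 0\<close> by simp
    also have "norm k \<le> real_of_int M" by (rule bound[OF k])
    finally show ?thesis by simp
  qed
  \<comment> \<open>Split off the factor \<open>X ^ n\<close> that belongs to the eigenvalue 0; the constant coefficient of
    the remaining factor is the product of the negated nonzero eigenvalues.\<close>
  define bs where "bs = filter (\<lambda>a. a \<noteq> 0) as"
  have split: "(\<Prod>a\<leftarrow>xs. [:- a, 1:]) =
      monom 1 (length (filter (\<lambda>a. a = 0) xs)) * (\<Prod>a\<leftarrow>filter (\<lambda>a. a \<noteq> 0) xs. [:- a, 1:])"
    for xs :: "complex list"
  proof (induction xs)
    case (Cons x xs)
    show ?case
    proof (cases "x = 0")
      case True
      with Cons show ?thesis by (simp add: monom_Suc)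
    next
      case False
      then show ?thesis
        by (simp only: list.map prod_list.Cons filter.simps if_True if_False Cons not_False_eq_True)
          (rule mult.left_commute)
    qed
  qed simp
  let ?n = "length (filter (\<lambda>a. a = 0) as)"
  have prod: "(\<Prod>a\<leftarrow>bs. - a) = coeff (char_poly C) ?n"
    unfolding as(1) split[of as] bs_def
    by (simp add: coeff_monom_mult poly_prod_list comp_def flip: poly_0_coeff_0)
  have "coeff (char_poly C) ?n \<in> \<int>"
    unfolding C(1) of_int_hom.char_poly_hom[OF C(3)] by simp
  then obtain z where z: "(\<Prod>a\<leftarrow>bs. - a) = of_int z" unfolding prod by (auto elim: Ints_cases)
  have "(\<Prod>a\<leftarrow>bs. - a) \<noteq> 0" by (auto simp: prod_list_zero_iff bs_def)
  then have "1 \<le> \<bar>z\<bar>" using z by auto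
  then have one: "1 \<le> norm (\<Prod>a\<leftarrow>bs. - a)" unfolding z by simp
  have kb: "k \<in> set bs" using k \<open>k \<noteq> 0\<close> by (simp add: bs_def)
  have bnd: "norm (\<Prod>a\<leftarrow>xs. - a) \<le> real_of_int M ^ length xs" if "set xs \<subseteq> set as" for xs
    using that M
    by (induction xs) (auto simp: norm_mult intro!: mult_mono bound)
  obtain xs ys where xy: "bs = xs @ k # ys" using split_list[OF kb] by auto
  have "norm (\<Prod>a\<leftarrow>xs @ ys. - a) \<le> real_of_int M ^ length (xs @ ys)"
  proof -
    have "set (xs @ ys) \<subseteq> set bs" by (auto simp: xy)
    also have "\<dots> \<subseteq> set as" by (auto simp: bs_def)
    finally show ?thesis using bnd by blast
  qed
  also have "\<dots> \<le> real_of_int M ^ d"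
  proof (rule power_increasing[OF _ M])
    have "length bs \<le> d" unfolding bs_def using as(2) length_filter_le by metis
    then show "length (xs @ ys) \<le> d" by (simp add: xy)
  qed
  finally have "norm (\<Prod>a\<leftarrow>xs @ ys. - a) \<le> real_of_int M ^ d" .
  moreover have "norm (\<Prod>a\<leftarrow>bs. - a) = norm k * norm (\<Prod>a\<leftarrow>xs @ ys. - a)"
    by (simp add: xy norm_mult)
  ultimately show ?thesis
    using one by (smt (verit) mult_left_mono norm_ge_zero)
qed

lemma pair_index_less: "i < d \<Longrightarrow> j < d' \<Longrightarrow> i * d' + j < d * (d' :: nat)"
proof -
  assume "i < d" "j < d'"
  then have "i * d' + j < Suc i * d'" by simp
  also have "\<dots> \<le> d * d'" using \<open>i < d\<close> by (intro mult_right_mono) auto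
  finally show ?thesis .
qed

lemma pair_index_div_mod: "i < d * d' \<Longrightarrow> i div d' < d \<and> i mod d' < (d' :: nat)"
  by (cases "d' = 0") (auto simp: less_mult_imp_div_less)

lemma sum_div_mod:
  fixes f :: "nat \<Rightarrow> nat \<Rightarrow> 'a :: comm_monoid_add"
  shows "(\<Sum>j<m * n. f (j div n) (j mod n)) = (\<Sum>a<m. \<Sum>b<n. f a b)"
proof -
  have "(\<Sum>j<m * n. f (j div n) (j mod n)) = (\<Sum>a<m. sum (\<lambda>j. f (j div n) (j mod n)) {a * n..<a * n + n})"
    using sum.nat_group[of "\<lambda>j. f (j div n) (j mod n)" n m] by simp
  also have "\<dots> = (\<Sum>a<m. \<Sum>b<n. f a b)"
  proof (rule sum.cong[OF refl])
    fix a
    show "(\<Sum>j = a * n..<a * n + n. f (j div n) (j mod n)) = (\<Sum>b<n. f a b)"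
      by (rule sum.reindex_bij_witness[of _ "\<lambda>b. a * n + b" "\<lambda>j. j - a * n"])
        (auto simp: div_nat_eqI mod_nat_eqI le_iff_add)
  qed
  finally show ?thesis .
qed

lemma integer_eigenvalue_cnj:
  assumes "integer_eigenvalue d M k"
  shows "integer_eigenvalue d M (cnj k)"
proof -
  obtain T w where w: "\<exists>i<d. w i \<noteq> 0" "\<And>i. i < d \<Longrightarrow> (\<Sum>j<d. complex_of_int (T i j) * w j) = k * w i"
    "\<And>i. i < d \<Longrightarrow> (\<Sum>j<d. \<bar>T i j\<bar>) \<le> M"
    using assms by (auto simp: integer_eigenvalue_def)
  have "(\<Sum>j<d. complex_of_int (T i j) * cnj (w j)) = cnj k * cnj (w i)" if "i < d" for i
    using arg_cong[OF w(2)[OF that], of cnj] by simp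
  with w show ?thesis
    unfolding integer_eigenvalue_def by (intro exI[of _ T] exI[of _ "\<lambda>i. cnj (w i)"]) auto
qed

text \<open>The Kronecker product of the two matrices has the tensor product of the two eigenvectors as
  an eigenvector. A pair of indices is coded as quotient and remainder modulo \<open>d'\<close>.\<close>

lemma integer_eigenvalue_mult:
  assumes "integer_eigenvalue d M k" "integer_eigenvalue d' M' k'"
  shows "integer_eigenvalue (d * d') (M * M') (k * k')"
proof -
  obtain T w where w: "\<exists>i<d. w i \<noteq> 0" "\<And>i. i < d \<Longrightarrow> (\<Sum>j<d. complex_of_int (T i j) * w j) = k * w i"
    "\<And>i. i < d \<Longrightarrow> (\<Sum>j<d. \<bar>T i j\<bar>) \<le> M"
    using assms(1) by (auto simp: integer_eigenvalue_def)
  obtain T' w' where w': "\<exists>i<d'. w' i \<noteq> 0"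
    "\<And>i. i < d' \<Longrightarrow> (\<Sum>j<d'. complex_of_int (T' i j) * w' j) = k' * w' i"
    "\<And>i. i < d' \<Longrightarrow> (\<Sum>j<d'. \<bar>T' i j\<bar>) \<le> M'"
    using assms(2) by (auto simp: integer_eigenvalue_def)
  define U where "U i j = T (i div d') (j div d') * T' (i mod d') (j mod d')" for i j
  define u where "u i = w (i div d') * w' (i mod d')" for i
  have "\<exists>i<d * d'. u i \<noteq> 0"
  proof -
    obtain i i' where "i < d" "w i \<noteq> 0" "i' < d'" "w' i' \<noteq> 0" using w(1) w'(1) by auto
    moreover from this have "i * d' + i' < d * d'" by (simp add: pair_index_less)
    ultimately show ?thesis by (intro exI[of _ "i * d' + i'"]) (simp add: u_def)
  qed
  moreover have "(\<Sum>j<d * d'. complex_of_int (U i j) * u j) = k * k' * u i" if "i < d * d'" for i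
  proof -
    from that have i: "i div d' < d" "i mod d' < d'"
      by (auto dest: pair_index_div_mod)
    have "(\<Sum>j<d * d'. complex_of_int (U i j) * u j) =
        (\<Sum>a<d. \<Sum>b<d'. (complex_of_int (T (i div d') a) * w a) * (complex_of_int (T' (i mod d') b) * w' b))"
      by (subst sum_div_mod[symmetric]) (simp add: U_def u_def mult_ac)
    also have "\<dots> = (k * w (i div d')) * (k' * w' (i mod d'))"
      unfolding w(2)[OF i(1), symmetric] w'(2)[OF i(2), symmetric] by (rule sum_product[symmetric])
    finally show ?thesis by (simp add: u_def)
  qed
  moreover have "(\<Sum>j<d * d'. \<bar>U i j\<bar>) \<le> M * M'" if "i < d * d'" for i
  proof -
    from that have i: "i div d' < d" "i mod d' < d'"
      by (auto dest: pair_index_div_mod)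
    have "(\<Sum>j<d * d'. \<bar>U i j\<bar>) = (\<Sum>a<d. \<bar>T (i div d') a\<bar>) * (\<Sum>b<d'. \<bar>T' (i mod d') b\<bar>)"
      unfolding sum_product by (subst sum_div_mod[symmetric]) (simp add: U_def abs_mult)
    also have "\<dots> \<le> M * M'"
      by (intro mult_mono w(3) w'(3) i sum_nonneg) (use order.trans[OF sum_nonneg w(3)[OF i(1)]] in auto)
    finally show ?thesis .
  qed
  ultimately show ?thesis unfolding integer_eigenvalue_def by blast
qed

text \<open>The same vector is an eigenvector of \<open>T \<otimes> 1 - 1 \<otimes> T'\<close>.\<close>

lemma integer_eigenvalue_diff:
  assumes "integer_eigenvalue d M k" "integer_eigenvalue d' M' k'"
  shows "integer_eigenvalue (d * d') (M + M') (k - k')"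
proof -
  obtain T w where w: "\<exists>i<d. w i \<noteq> 0" "\<And>i. i < d \<Longrightarrow> (\<Sum>j<d. complex_of_int (T i j) * w j) = k * w i"
    "\<And>i. i < d \<Longrightarrow> (\<Sum>j<d. \<bar>T i j\<bar>) \<le> M"
    using assms(1) by (auto simp: integer_eigenvalue_def)
  obtain T' w' where w': "\<exists>i<d'. w' i \<noteq> 0"
    "\<And>i. i < d' \<Longrightarrow> (\<Sum>j<d'. complex_of_int (T' i j) * w' j) = k' * w' i"
    "\<And>i. i < d' \<Longrightarrow> (\<Sum>j<d'. \<bar>T' i j\<bar>) \<le> M'"
    using assms(2) by (auto simp: integer_eigenvalue_def)
  define V where "V a b a' b' = (if b = b' then T a a' else 0) - (if a = a' then T' b b' else 0)" for a b a' b'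
  define u where "u i = w (i div d') * w' (i mod d')" for i
  have "\<exists>i<d * d'. u i \<noteq> 0"
  proof -
    obtain i i' where "i < d" "w i \<noteq> 0" "i' < d'" "w' i' \<noteq> 0" using w(1) w'(1) by auto
    moreover from this have "i * d' + i' < d * d'" by (simp add: pair_index_less)
    ultimately show ?thesis by (intro exI[of _ "i * d' + i'"]) (simp add: u_def)
  qed
  moreover have "(\<Sum>j<d * d'. complex_of_int (V (i div d') (i mod d') (j div d') (j mod d')) * u j) = (k - k') * u i"
    if "i < d * d'" for i
  proof -
    define p q where "p = i div d'" and "q = i mod d'"
    from that have i: "p < d" "q < d'"
      by (auto simp: p_def q_def dest: pair_index_div_mod)
    have "(\<Sum>j<d * d'. complex_of_int (V p q (j div d') (j mod d')) * u j) =
        (\<Sum>a<d. \<Sum>b<d'. complex_of_int (V p q a b) * (w a * w' b))"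
      by (subst sum_div_mod[symmetric]) (simp add: u_def)
    also have "\<dots> = (\<Sum>a<d. \<Sum>b<d'. if b = q then complex_of_int (T p a) * w a * w' q else 0)
        - (\<Sum>a<d. \<Sum>b<d'. if a = p then complex_of_int (T' q b) * w' b * w p else 0)"
      unfolding sum_subtractf[symmetric] by (intro sum.cong refl) (auto simp: V_def algebra_simps)
    also have "\<dots> = (\<Sum>a<d. complex_of_int (T p a) * w a) * w' q - (\<Sum>b<d'. complex_of_int (T' q b) * w' b) * w p"
      using i by (subst (2) sum.swap) (simp add: sum_distrib_right)
    also have "\<dots> = (k - k') * u i"
      unfolding w(2)[OF i(1)] w'(2)[OF i(2)] by (simp add: u_def algebra_simps flip: p_def q_def)
    finally show ?thesis by (simp add: p_def q_def)
  qed
  moreover have "(\<Sum>j<d * d'. \<bar>V (i div d') (i mod d') (j div d') (j mod d')\<bar>) \<le> M + M'" if "i < d * d'" for i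
  proof -
    define p q where "p = i div d'" and "q = i mod d'"
    from that have i: "p < d" "q < d'"
      by (auto simp: p_def q_def dest: pair_index_div_mod)
    have "(\<Sum>j<d * d'. \<bar>V p q (j div d') (j mod d')\<bar>) = (\<Sum>a<d. \<Sum>b<d'. \<bar>V p q a b\<bar>)"
      by (rule sum_div_mod)
    also have "\<dots> \<le> (\<Sum>a<d. \<Sum>b<d'. (if b = q then \<bar>T p a\<bar> else 0) + (if a = p then \<bar>T' q b\<bar> else 0))"
      by (intro sum_mono) (auto simp: V_def)
    also have "\<dots> = (\<Sum>a<d. \<bar>T p a\<bar>) + (\<Sum>b<d'. \<bar>T' q b\<bar>)"
      unfolding sum.distrib using i by (subst (2) sum.swap) simp
    also have "\<dots> \<le> M + M'" by (intro add_mono w(3) w'(3) i)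
    finally show ?thesis by (simp add: p_def q_def)
  qed
  ultimately show ?thesis unfolding integer_eigenvalue_def
    by (intro exI[of _ "\<lambda>i j. V (i div d') (i mod d') (j div d') (j mod d')"] exI[of _ u] conjI) simp_all
qed

text \<open>A squared modulus is the product of an eigenvalue and its conjugate, which is an eigenvalue
  too. Hence the difference of two squared moduli is itself an eigenvalue of an integer matrix,
  of size \<open>d ^ 4\<close>, and the lower bound for nonzero eigenvalues applies to it.\<close>

lemma eigenvalue_modulus_gap:
  assumes "integer_eigenvalue d M a" "integer_eigenvalue d M b" "norm b < norm a"
  shows "(norm b)\<^sup>2 + 1 / (2 * M\<^sup>2) ^ (d ^ 4) \<le> (norm a)\<^sup>2"
proof -
  define r where "r = (norm a)\<^sup>2 - (norm b)\<^sup>2"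
  have pos: "r > 0" using assms(3) by (simp add: r_def power_strict_mono)
  have "integer_eigenvalue (d * d * (d * d)) (M * M + M * M) (a * cnj a - b * cnj b)"
    by (intro integer_eigenvalue_diff integer_eigenvalue_mult integer_eigenvalue_cnj assms)
  moreover have "a * cnj a - b * cnj b = complex_of_real r"
    by (simp only: r_def of_real_diff complex_norm_square)
  moreover have "M * M + M * M = 2 * M\<^sup>2" by (simp add: power2_eq_square)
  moreover have "d * d * (d * d) = d ^ 4" by (simp add: power4_eq_xxxx mult.assoc)
  ultimately have ev: "integer_eigenvalue (d ^ 4) (2 * M\<^sup>2) (complex_of_real r)"
    by (simp only:)
  have "1 \<le> norm (complex_of_real r) * real_of_int (2 * M\<^sup>2) ^ (d ^ 4)"
    by (rule integer_eigenvalue_lower_bound[OF ev]) (use pos in simp)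
  then have le: "1 \<le> r * (2 * (real_of_int M)\<^sup>2) ^ (d ^ 4)"
    using pos by simp
  then have "0 < r * (2 * (real_of_int M)\<^sup>2) ^ (d ^ 4)" by linarith
  then have "(2 * (real_of_int M)\<^sup>2) ^ (d ^ 4) > 0"
    using pos zero_less_mult_pos by blast
  with le have "1 / (2 * (real_of_int M)\<^sup>2) ^ (d ^ 4) \<le> r"
    by (simp only: pos_divide_le_eq)
  then show ?thesis by (simp add: r_def algebra_simps)
qed

section \<open>The sign of a power sum with a dominant term\<close>

text \<open>After squaring this is Bernoulli's inequality for \<open>x\<^sup>2 / y\<^sup>2\<close>, which is at least
  \<open>1 + \<delta> / R\<^sup>2\<close>.\<close>

lemma power_dominates:
  fixes x y \<delta> R c :: real
  assumes "0 \<le> x" "0 \<le> y" "x \<le> R" "0 < \<delta>" and gap: "y\<^sup>2 + \<delta> \<le> x\<^sup>2" and "c\<^sup>2 * R\<^sup>2 \<le> real n * \<delta>" "1 \<le> n"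
  shows "c * y ^ n \<le> x ^ n"
proof (cases "y = 0")
  case True
  then show ?thesis using assms by (simp add: power_0_left)
next
  case False
  have xR: "x\<^sup>2 \<le> R\<^sup>2" using assms by (simp add: power_mono)
  have y2: "0 < y\<^sup>2" using False by simp
  have "c\<^sup>2 * y\<^sup>2 \<le> c\<^sup>2 * R\<^sup>2" using xR gap \<open>0 < \<delta>\<close> by (intro mult_left_mono) auto
  also have "\<dots> \<le> real n * \<delta>" by fact
  finally have "c\<^sup>2 \<le> real n * (\<delta> / y\<^sup>2)" using y2 by (simp add: field_simps)
  also have "\<dots> \<le> (1 + \<delta> / y\<^sup>2) ^ n"
    using Bernoulli_inequality[of "\<delta> / y\<^sup>2" n] y2 \<open>0 < \<delta>\<close> by (smt (verit) divide_pos_pos)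
  finally have "c\<^sup>2 * (y\<^sup>2) ^ n \<le> (1 + \<delta> / y\<^sup>2) ^ n * (y\<^sup>2) ^ n"
    by (intro mult_right_mono) auto
  also have "\<dots> = (y\<^sup>2 + \<delta>) ^ n"
    using y2 by (simp add: field_simps flip: power_mult_distrib)
  also have "\<dots> \<le> (x\<^sup>2) ^ n" using gap \<open>0 < \<delta>\<close> by (intro power_mono) auto
  finally have "(c * y ^ n)\<^sup>2 \<le> (x ^ n)\<^sup>2"
    by (simp add: power_mult_distrib power_mult[symmetric] mult.commute)
  then show ?thesis by (rule power2_le_imp_le) (use assms in simp)
qed

text \<open>Collect equal bases, so that \<open>c v\<close> is the total weight of the base \<open>v\<close>. The term of the
  dominant base \<open>x0\<close> has an integer weight of absolute value at least 1, so the other weights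
  add up to at most \<open>s - 1\<close> in absolute value. For the exponents under consideration each
  other base of nonzero weight contributes at most the fraction \<open>1 / s\<close> of \<open>\<bar>x0\<bar> ^ n\<close> per unit of weight, so
  the dominant term decides the sign. The weights are needed because a base with total weight 0 may
  exceed \<open>x0\<close>; this occurs for odd exponents when opposite eigenvalues cancel.\<close>

lemma power_sum_sign:
  fixes \<phi> :: "nat \<Rightarrow> complex" and g :: "nat \<Rightarrow> int" and s :: nat
  defines "c \<equiv> \<lambda>v. \<Sum>i | i < s \<and> \<phi> i = v. g i"
  assumes g: "\<And>i. i < s \<Longrightarrow> \<bar>g i\<bar> \<le> 1"
    and bound: "\<And>i. i < s \<Longrightarrow> norm (\<phi> i) \<le> R"
    and gap: "\<And>i j. i < s \<Longrightarrow> j < s \<Longrightarrow> norm (\<phi> i) < norm (\<phi> j) \<Longrightarrow> (norm (\<phi> i))\<^sup>2 + \<delta> \<le> (norm (\<phi> j))\<^sup>2"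
    and "0 < \<delta>"
    and x0: "x0 \<in> \<phi> ` {..<s}" "x0 \<in> \<real>" "c x0 \<noteq> 0"
    and dom: "\<And>i. i < s \<Longrightarrow> c (\<phi> i) \<noteq> 0 \<Longrightarrow> \<phi> i \<noteq> x0 \<Longrightarrow> norm (\<phi> i) < norm x0"
    and n: "(real s)\<^sup>2 * R\<^sup>2 \<le> real n * \<delta>" "1 \<le> n"
  shows "sgn (Re (\<Sum>i<s. of_int (g i) * \<phi> i ^ n)) = sgn (real_of_int (c x0) * Re x0 ^ n)"
proof -
  define V where "V = \<phi> ` {..<s}"
  have V: "finite V" "x0 \<in> V" using x0(1) by (auto simp: V_def)
  have sum_eq: "(\<Sum>i<s. of_int (g i) * \<phi> i ^ n) = (\<Sum>v\<in>V. of_int (c v) * v ^ n)"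
  proof -
    have "(\<Sum>i<s. of_int (g i) * \<phi> i ^ n) =
        (\<Sum>v\<in>V. \<Sum>i | i \<in> {..<s} \<and> \<phi> i = v. of_int (g i) * \<phi> i ^ n)"
      unfolding V_def by (rule sum.image_gen) simp
    also have "\<dots> = (\<Sum>v\<in>V. of_int (c v) * v ^ n)"
      by (intro sum.cong refl) (simp add: c_def sum_distrib_right)
    finally show ?thesis .
  qed
  define rest where "rest = (\<Sum>v\<in>V - {x0}. of_int (c v) * v ^ n)"
  define y where "y = Re x0"
  have x0y: "x0 = complex_of_real y" using x0(2) by (simp add: y_def)
  have split: "(\<Sum>i<s. of_int (g i) * \<phi> i ^ n) = of_int (c x0) * x0 ^ n + rest"
    unfolding sum_eq rest_def by (rule sum.remove[OF V])
  have Re_split: "Re (\<Sum>i<s. of_int (g i) * \<phi> i ^ n) = real_of_int (c x0) * y ^ n + Re rest"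
    unfolding split by (simp add: x0y flip: of_real_power)
  show ?thesis
  proof (cases "x0 = 0")
    case True
    have "of_int (c v) * v ^ n = 0" if "v \<in> V - {x0}" for v
    proof -
      from that obtain i where "i < s" "v = \<phi> i" "v \<noteq> x0" by (auto simp: V_def)
      with dom[of i] True have "c v = 0" by fastforce
      then show ?thesis by simp
    qed
    then have "rest = 0" unfolding rest_def by (rule sum.neutral[OF ballI])
    then show ?thesis using Re_split by (simp add: y_def)
  next
    case False
    then have pos: "0 < norm x0" by simp
    have c_total: "(\<Sum>v\<in>V. \<bar>c v\<bar>) \<le> int s"
    proof -
      have "(\<Sum>v\<in>V. \<bar>c v\<bar>) \<le> (\<Sum>v\<in>V. \<Sum>i | i \<in> {..<s} \<and> \<phi> i = v. \<bar>g i\<bar>)"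
        unfolding c_def by (intro sum_mono) (auto intro: order.trans[OF sum_abs])
      also have "\<dots> = (\<Sum>i<s. \<bar>g i\<bar>)"
        unfolding V_def by (rule sum.image_gen[symmetric]) simp
      also have "\<dots> \<le> (\<Sum>i<s. 1)" by (intro sum_mono g) simp
      finally show ?thesis by simp
    qed
    have "(\<Sum>v\<in>V. \<bar>c v\<bar>) = \<bar>c x0\<bar> + (\<Sum>v\<in>V - {x0}. \<bar>c v\<bar>)"
      by (rule sum.remove[OF V])
    with c_total x0(3) have c_rest: "(\<Sum>v\<in>V - {x0}. \<bar>c v\<bar>) \<le> int s - 1" by linarith
    have term_le: "real s * norm (of_int (c v) * v ^ n) \<le> real_of_int \<bar>c v\<bar> * norm x0 ^ n"
      if "v \<in> V - {x0}" for v
    proof (cases "c v = 0")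
      case False
      from that obtain i where i: "i < s" "v = \<phi> i" "v \<noteq> x0" by (auto simp: V_def)
      obtain j where j: "j < s" "x0 = \<phi> j" using x0(1) by auto
      have lt: "norm v < norm x0" using dom[of i] i False by simp
      have "real s * norm v ^ n \<le> norm x0 ^ n"
        by (rule power_dominates[of _ _ R \<delta>])
          (use gap[of i j] bound[of j] lt n i j \<open>0 < \<delta>\<close> in auto)
      then have "real_of_int \<bar>c v\<bar> * (real s * norm v ^ n) \<le> real_of_int \<bar>c v\<bar> * norm x0 ^ n"
        by (intro mult_left_mono) auto
      then show ?thesis by (simp add: norm_mult norm_power mult_ac)
    qed simp
    have "real s * norm rest \<le> real s * (\<Sum>v\<in>V - {x0}. norm (of_int (c v) * v ^ n))"
      unfolding rest_def by (intro mult_left_mono norm_sum) auto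
    also have "\<dots> \<le> (\<Sum>v\<in>V - {x0}. real_of_int \<bar>c v\<bar> * norm x0 ^ n)"
      unfolding sum_distrib_left by (intro sum_mono term_le)
    also have "\<dots> = real_of_int (\<Sum>v\<in>V - {x0}. \<bar>c v\<bar>) * norm x0 ^ n"
      by (simp add: sum_distrib_right)
    also have "\<dots> \<le> real_of_int (int s - 1) * norm x0 ^ n"
      using c_rest by (intro mult_right_mono) (simp_all only: of_int_le_iff zero_le_power norm_ge_zero)
    also have "\<dots> < real s * norm x0 ^ n"
      using pos by (intro mult_strict_right_mono) auto
    finally have "norm rest < norm x0 ^ n"
      by (simp add: mult_less_cancel_left)
    also have "norm x0 ^ n = 1 * \<bar>y\<bar> ^ n" by (simp add: x0y)
    also have "\<dots> \<le> \<bar>real_of_int (c x0)\<bar> * \<bar>y\<bar> ^ n"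
      using x0(3) by (intro mult_right_mono) (auto simp flip: of_int_abs)
    finally have "\<bar>Re rest\<bar> < \<bar>real_of_int (c x0) * y ^ n\<bar>"
      using abs_Re_le_cmod[of rest] by (simp add: abs_mult power_abs)
    moreover have "sgn (p + q) = sgn p" if "\<bar>q\<bar> < \<bar>p\<bar>" for p q :: real
      using that by (auto simp: sgn_if)
    ultimately show ?thesis unfolding Re_split y_def[symmetric] by blast
  qed
qed

text \<open>Increasing the exponent by two multiplies a real dominant term by a square, even if its base
  is negative.\<close>

lemma dominant_sign_step:
  fixes u v c y :: real
  assumes "sgn u = sgn (c * y ^ n)" "sgn v = sgn (c * y ^ (n + 2))" "0 \<le> u"
  shows "0 \<le> v"
proof -
  have sgn_nonneg: "0 \<le> q" if "sgn p = sgn q" "0 \<le> p" for p q :: real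
    using that by (auto simp: sgn_if split: if_splits)
  have "0 \<le> c * y ^ n" using assms(1,3) by (rule sgn_nonneg)
  then have "0 \<le> c * y ^ n * y\<^sup>2" by (rule mult_nonneg_nonneg) simp
  also have "\<dots> = c * y ^ (n + 2)" by (simp only: power_add mult.assoc)
  finally show ?thesis using assms(2) by (metis sgn_nonneg)
qed

lemma unique_dominant_power_sum_step:
  fixes a :: "nat \<Rightarrow> complex"
  assumes bound: "\<And>i. i < s \<Longrightarrow> norm (a i) \<le> R"
    and gap: "\<And>i j. i < s \<Longrightarrow> j < s \<Longrightarrow> norm (a i) < norm (a j) \<Longrightarrow> (norm (a i))\<^sup>2 + \<delta> \<le> (norm (a j))\<^sup>2"
    and \<delta>: "0 < \<delta>"
    and l: "l \<in> a ` {..<s}" "l \<in> \<real>" "\<And>i. i < s \<Longrightarrow> a i \<noteq> l \<Longrightarrow> norm (a i) < norm l"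
    and n: "(real s)\<^sup>2 * R\<^sup>2 \<le> real n * \<delta>" "1 \<le> n"
    and nonneg: "0 \<le> Re (\<Sum>i<s. a i ^ n)"
  shows "0 \<le> Re (\<Sum>i<s. a i ^ (n + 2))"
proof -
  define c where "c = (\<Sum>i | i < s \<and> a i = l. 1 :: int)"
  have "{i. i < s \<and> a i = l} \<noteq> {}" using l(1) by auto
  then have c: "c \<noteq> 0" by (simp add: c_def)
  have sign: "sgn (Re (\<Sum>i<s. a i ^ m)) = sgn (real_of_int c * Re l ^ m)" if "n \<le> m" for m
  proof -
    have "(real s)\<^sup>2 * R\<^sup>2 \<le> real m * \<delta>"
      using n(1) \<delta> that by (elim order.trans) (simp add: mult_right_mono)
    then show ?thesis
      using power_sum_sign[of s "\<lambda>_. 1" a R \<delta> l m] bound gap \<delta> l c n(2) that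
      by (simp add: c_def)
  qed
  show ?thesis
    by (rule dominant_sign_step[OF sign[of n] sign[of "n + 2"] nonneg]) auto
qed

text \<open>Even exponents give sums of squares. For an odd exponent \<open>b ^ n\<close> is \<open>\<bar>b\<bar> ^ n\<close> with the sign
  of \<open>b\<close>, so the sum becomes a weighted one with nonnegative bases, in which opposite eigenvalues
  have already been merged. Either all weights vanish, and the sum is 0 for every odd exponent, or
  the largest base of nonzero weight is strictly dominant.\<close>

lemma real_power_sum_step:
  fixes a :: "nat \<Rightarrow> complex"
  assumes bound: "\<And>i. i < s \<Longrightarrow> norm (a i) \<le> R"
    and gap: "\<And>i j. i < s \<Longrightarrow> j < s \<Longrightarrow> norm (a i) < norm (a j) \<Longrightarrow> (norm (a i))\<^sup>2 + \<delta> \<le> (norm (a j))\<^sup>2"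
    and \<delta>: "0 < \<delta>"
    and real: "\<And>i. i < s \<Longrightarrow> a i \<in> \<real>"
    and n: "(real s)\<^sup>2 * R\<^sup>2 \<le> real n * \<delta>" "1 \<le> n"
    and nonneg: "0 \<le> Re (\<Sum>i<s. a i ^ n)"
  shows "0 \<le> Re (\<Sum>i<s. a i ^ (n + 2))"
proof -
  define b where "b i = Re (a i)" for i
  have ab: "a i = complex_of_real (b i)" if "i < s" for i using real[OF that] by (simp add: b_def)
  have Re_eq: "Re (\<Sum>i<s. a i ^ m) = (\<Sum>i<s. b i ^ m)" for m
    by (simp add: ab flip: of_real_power)
  show ?thesis
  proof (cases "even n")
    case True
    then show ?thesis unfolding Re_eq by (intro sum_nonneg zero_le_even_power) simp
  next
    case False
    \<comment> \<open>A base 0 contributes 0 with either sign; 1 is a default there.\<close>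
    define g :: "nat \<Rightarrow> int" where "g i = (if b i < 0 then -1 else 1)" for i
    define \<phi> where "\<phi> i = complex_of_real \<bar>b i\<bar>" for i
    define c where "c v = (\<Sum>i | i < s \<and> \<phi> i = v. g i)" for v
    have norm_\<phi>: "norm (\<phi> i) = norm (a i)" if "i < s" for i by (simp add: \<phi>_def ab that)
    have odd_sum: "(\<Sum>i<s. of_int (g i) * \<phi> i ^ m) = (\<Sum>i<s. a i ^ m)" if "odd m" for m
      using that by (intro sum.cong refl) (auto simp: g_def \<phi>_def ab simp flip: of_real_power)
    have odd: "odd n" "odd (n + 2)" using False by auto
    show ?thesis
    proof (cases "\<exists>i<s. c (\<phi> i) \<noteq> 0")
      case True
      define X where "X = {i. i < s \<and> c (\<phi> i) \<noteq> 0}"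
      have X: "finite X" "X \<noteq> {}" using True by (auto simp: X_def)
      have "Max ((\<lambda>i. \<bar>b i\<bar>) ` X) \<in> (\<lambda>i. \<bar>b i\<bar>) ` X" using X by (intro Max_in) auto
      then obtain k where k: "k \<in> X" "\<bar>b k\<bar> = Max ((\<lambda>i. \<bar>b i\<bar>) ` X)" by auto
      have k_max: "\<bar>b i\<bar> \<le> \<bar>b k\<bar>" if "i \<in> X" for i
        unfolding k(2) using X that by (intro Max_ge) auto
      have dom: "norm (\<phi> i) < norm (\<phi> k)" if "i < s" "c (\<phi> i) \<noteq> 0" "\<phi> i \<noteq> \<phi> k" for i
        using k_max[of i] that by (auto simp: X_def \<phi>_def)
      have sign: "sgn (Re (\<Sum>i<s. a i ^ m)) = sgn (real_of_int (c (\<phi> k)) * Re (\<phi> k) ^ m)"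
        if "n \<le> m" "odd m" for m
        unfolding odd_sum[OF that(2), symmetric] c_def
      proof (rule power_sum_sign[of s g \<phi> R \<delta> "\<phi> k" m])
        show "(real s)\<^sup>2 * R\<^sup>2 \<le> real m * \<delta>"
          using n(1) \<delta> that by (elim order.trans) (simp add: mult_right_mono)
        show "\<phi> k \<in> \<real>" by (simp add: \<phi>_def)
      qed (use bound gap \<delta> n(2) that k(1) dom in \<open>auto simp: norm_\<phi> c_def X_def g_def\<close>)
      show ?thesis
        by (rule dominant_sign_step[OF sign[of n] sign[of "n + 2"] nonneg]) (use odd in auto)
    next
      case False
      have "(\<Sum>i<s. a i ^ (n + 2)) =
          (\<Sum>v\<in>\<phi> ` {..<s}. \<Sum>i | i \<in> {..<s} \<and> \<phi> i = v. of_int (g i) * \<phi> i ^ (n + 2))"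
        unfolding odd_sum[OF odd(2), symmetric] by (rule sum.image_gen) simp
      also have "\<dots> = (\<Sum>v\<in>\<phi> ` {..<s}. of_int (c v) * v ^ (n + 2))"
        unfolding c_def of_int_sum sum_distrib_right by (intro sum.cong refl) auto
      also have "\<dots> = 0" by (intro sum.neutral) (use False in auto)
      finally show ?thesis by simp
    qed
  qed
qed

section \<open>Trace moments of integer matrices\<close>

definition int_mat :: "nat \<Rightarrow> (nat \<Rightarrow> nat \<Rightarrow> int) \<Rightarrow> int mat" where
  "int_mat s B = mat s s (\<lambda>(i, j). B i j)"

text \<open>The sum of the absolute values of all entries bounds every absolute row sum, and the successor
  keeps it positive, also for the zero matrix.\<close>

definition entry_bound :: "nat \<Rightarrow> (nat \<Rightarrow> nat \<Rightarrow> int) \<Rightarrow> nat" where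
  "entry_bound s B = Suc (\<Sum>i<s. \<Sum>j<s. nat \<bar>B i j\<bar>)"

text \<open>With \<open>H\<close> the entry bound, eigenvalues are at most \<open>H\<close> in modulus and the gap between distinct
  squared moduli is at least \<open>\<delta> = 1 / (2 * H\<^sup>2) ^ (s ^ 4)\<close>. The threshold is the exponent
  \<open>s\<^sup>2 * H\<^sup>2 / \<delta>\<close> from which on the dominant term outweighs the others, increased by 1 so that it
  is positive.\<close>

definition moment_threshold :: "nat \<Rightarrow> (nat \<Rightarrow> nat \<Rightarrow> int) \<Rightarrow> nat" where
  "moment_threshold s B =
    Suc (s ^ 2 * entry_bound s B ^ 2 * (2 * entry_bound s B ^ 2) ^ (s ^ 4))"

text \<open>The threshold is chosen so that the power sum lemmas apply to the eigenvalues with the gap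
  for integer matrices. A step of two is needed because a negative dominant eigenvalue, or the odd
  moments of a real spectrum, make the sign depend on the parity of the exponent.\<close>

lemma moment_step:
  fixes B :: "nat \<Rightarrow> nat \<Rightarrow> int" and s :: nat
  defines "C \<equiv> map_mat complex_of_int (int_mat s B)"
  assumes cond: "(\<exists>l\<in>spectrum C. l \<in> \<real> \<and> (\<forall>m\<in>spectrum C. m \<noteq> l \<longrightarrow> norm m < norm l)) \<or> spectrum C \<subseteq> \<real>"
    and n: "moment_threshold s B \<le> n"
    and nonneg: "0 \<le> mat_trace (int_mat s B ^\<^sub>m n)"
  shows "0 \<le> mat_trace (int_mat s B ^\<^sub>m (n + 2))"
proof -
  have C: "C \<in> carrier_mat s s" "int_mat s B \<in> carrier_mat s s" by (auto simp: C_def int_mat_def)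
  obtain as where as: "char_poly C = (\<Prod>a\<leftarrow>as. [:- a, 1:])" "length as = s"
    using char_poly_factorized[OF C(1)] by auto
  have spec: "spectrum C = (!) as ` {..<s}"
    using spectrum_eq_set[OF C(1) as(1)] as(2) by (auto simp: set_conv_nth)
  have Re_trace: "Re (\<Sum>i<s. (as ! i) ^ k) = real_of_int (mat_trace (int_mat s B ^\<^sub>m k))" for k
  proof -
    have "C ^\<^sub>m k = map_mat complex_of_int (int_mat s B ^\<^sub>m k)"
      unfolding C_def by (rule of_int_hom.mat_hom_pow[OF C(2), symmetric])
    then have "mat_trace (C ^\<^sub>m k) = complex_of_int (mat_trace (int_mat s B ^\<^sub>m k))"
      using C by (simp add: mat_trace_def int_mat_def)
    then show ?thesis by (simp add: mat_trace_pow_eq_power_sum[OF C(1) as(1) as(2), symmetric])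
  qed
  define H where "H = entry_bound s B"
  define \<delta> where "\<delta> = 1 / (2 * (real H)\<^sup>2) ^ (s ^ 4)"
  have H: "1 \<le> H" by (simp add: H_def entry_bound_def)
  have ev: "integer_eigenvalue s (int H) (as ! i)" if "i < s" for i
  proof -
    have "eigenvalue C (as ! i)" using spec that by (auto simp: spectrum_def)
    moreover have eq: "C = mat s s (\<lambda>(i, j). complex_of_int (B i j))"
      by (auto simp: C_def int_mat_def)
    ultimately obtain w where w: "\<exists>i<s. w i \<noteq> 0"
      "\<forall>l<s. (\<Sum>j<s. complex_of_int (B l j) * w j) = as ! i * w l"
      unfolding eq eigenvalue_mat_iff by blast
    have "(\<Sum>j<s. \<bar>B i j\<bar>) \<le> int H" if "i < s" for i
    proof -
      have "(\<Sum>j<s. \<bar>B i j\<bar>) \<le> (\<Sum>i<s. \<Sum>j<s. \<bar>B i j\<bar>)"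
        by (rule member_le_sum[of i "{..<s}" "\<lambda>i. \<Sum>j<s. \<bar>B i j\<bar>"]) (use that in \<open>auto intro: sum_nonneg\<close>)
      also have "\<dots> \<le> int H" by (simp add: H_def entry_bound_def)
      finally show ?thesis .
    qed
    with w show ?thesis unfolding integer_eigenvalue_def by blast
  qed
  have bound: "norm (as ! i) \<le> real H" if "i < s" for i
    using norm_integer_eigenvalue_le[OF ev[OF that]] by simp
  have gap: "(norm (as ! i))\<^sup>2 + \<delta> \<le> (norm (as ! j))\<^sup>2"
    if "i < s" "j < s" "norm (as ! i) < norm (as ! j)" for i j
    using eigenvalue_modulus_gap[OF ev[OF that(2)] ev[OF that(1)] that(3)] by (simp add: \<delta>_def)
  have \<delta>: "0 < \<delta>" using H by (simp add: \<delta>_def)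
  have n': "(real s)\<^sup>2 * (real H)\<^sup>2 \<le> real n * \<delta>"
  proof -
    have "real (s ^ 2 * H ^ 2 * (2 * H ^ 2) ^ (s ^ 4)) \<le> real n"
      using n unfolding moment_threshold_def H_def by (simp only: of_nat_le_iff)
    then have "(real s)\<^sup>2 * (real H)\<^sup>2 * (2 * (real H)\<^sup>2) ^ (s ^ 4) \<le> real n"
      by simp
    moreover have "0 < (2 * (real H)\<^sup>2) ^ (s ^ 4)" using H by simp
    ultimately show ?thesis by (simp only: \<delta>_def pos_le_divide_eq times_divide_eq_right mult_1_right)
  qed
  have n1: "1 \<le> n" using n by (simp add: moment_threshold_def)
  have nonneg': "0 \<le> Re (\<Sum>i<s. (as ! i) ^ n)" using nonneg by (simp only: Re_trace of_int_0_le_iff)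
  have "0 \<le> Re (\<Sum>i<s. (as ! i) ^ (n + 2))"
    using cond
  proof
    assume "\<exists>l\<in>spectrum C. l \<in> \<real> \<and> (\<forall>m\<in>spectrum C. m \<noteq> l \<longrightarrow> norm m < norm l)"
    then obtain l where l: "l \<in> (!) as ` {..<s}" "l \<in> \<real>"
      "\<And>i. i < s \<Longrightarrow> as ! i \<noteq> l \<Longrightarrow> norm (as ! i) < norm l"
      unfolding spec by auto
    show ?thesis
      by (rule unique_dominant_power_sum_step[OF bound gap \<delta> l n' n1 nonneg'])
  next
    assume "spectrum C \<subseteq> \<real>"
    then have "as ! i \<in> \<real>" if "i < s" for i using spec that by auto
    then show ?thesis
      by (intro real_power_sum_step[OF bound gap \<delta> _ n' n1 nonneg'])
  qed
  then show ?thesis by (simp only: Re_trace of_int_0_le_iff)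
qed

lemma all_nonneg_iff_bounded:
  fixes t :: "nat \<Rightarrow> int"
  assumes step: "\<And>n. N \<le> n \<Longrightarrow> 0 \<le> t n \<Longrightarrow> 0 \<le> t (n + 2)"
  shows "(\<forall>n. 0 \<le> t n) \<longleftrightarrow> (\<forall>n<N + 2. 0 \<le> t n)"
proof (intro iffI allI)
  fix n assume *: "\<forall>n<N + 2. 0 \<le> t n"
  show "0 \<le> t n"
  proof (induction n rule: less_induct)
    case (less n)
    show ?case
    proof (cases "n < N + 2")
      case False
      then have "0 \<le> t (n - 2 + 2)" by (intro step less.IH) auto
      moreover have "n - 2 + 2 = n" using False by simp
      ultimately show ?thesis by (simp only:)
    qed (use * in simp)
  qed
qed simp

section \<open>Clearing denominators\<close>

text \<open>The numerator of an entry times the denominators of all other entries: this is the entry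
  multiplied by the product of all denominators, computed without a division.\<close>

definition cleared_entry :: "nat \<Rightarrow> nat \<Rightarrow> nat \<Rightarrow> nat \<Rightarrow> int" where
  "cleared_entry s e i j = int_decode (fst (prod_decode (code_entry e i j))) *
    (\<Prod>(k, l)\<in>{..<s} \<times> {..<s} - {(i, j)}. int (snd (prod_decode (code_entry e k l))))"

lemma code_entry_mat_encode:
  assumes "A \<in> carrier_mat s s" "i < s" "j < s"
  shows "code_entry (mat_encode A) i j = rat_encode (A $$ (i, j))"
  using assms by (simp add: code_entry_def mat_encode_def code_nth_list_encode mat_to_list_def)

lemma cleared_entry_mat_encode:
  assumes A: "A \<in> carrier_mat s s"
  obtains D :: nat where "0 < D"
    "\<And>i j. i < s \<Longrightarrow> j < s \<Longrightarrow> rat_of_int (cleared_entry s (mat_encode A) i j) = of_nat D * A $$ (i, j)"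
proof -
  define num where "num i j = fst (quotient_of (A $$ (i, j)))" for i j
  define den where "den i j = snd (quotient_of (A $$ (i, j)))" for i j
  have den: "0 < den i j" for i j unfolding den_def by (rule quotient_of_denom_pos')
  have frac: "A $$ (i, j) = of_int (num i j) / of_int (den i j)" for i j
    unfolding num_def den_def by (rule quotient_of_div) simp
  have enc: "code_entry (mat_encode A) i j = prod_encode (int_encode (num i j), nat (den i j))"
    if "i < s" "j < s" for i j
    using code_entry_mat_encode[OF A that] by (simp add: rat_encode_def num_def den_def split_beta)
  define D where "D = (\<Prod>(k, l)\<in>{..<s} \<times> {..<s}. den k l)"
  have D: "0 < D" unfolding D_def by (rule prod_pos) (auto simp: den)
  show thesis
  proof (rule that[of "nat D"])
    show "0 < nat D" using D by simp
    fix i j assume ij: "i < s" "j < s"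
    have "cleared_entry s (mat_encode A) i j =
        num i j * (\<Prod>(k, l)\<in>{..<s} \<times> {..<s} - {(i, j)}. den k l)"
      unfolding cleared_entry_def enc[OF ij]
      by (intro arg_cong2[of _ _ _ _ "(*)"] prod.cong) (auto simp: enc den less_imp_le)
    moreover have "D = den i j * (\<Prod>(k, l)\<in>{..<s} \<times> {..<s} - {(i, j)}. den k l)"
      unfolding D_def using ij by (subst prod.remove[of _ "(i, j)"]) auto
    ultimately have "cleared_entry s (mat_encode A) i j * den i j = D * num i j"
      by (simp add: mult_ac)
    then have "rat_of_int (cleared_entry s (mat_encode A) i j) * of_int (den i j) = of_int D * of_int (num i j)"
      by (simp only: flip: of_int_mult)
    then show "rat_of_int (cleared_entry s (mat_encode A) i j) = of_nat (nat D) * A $$ (i, j)"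
      using den[of i j] D by (simp add: frac field_simps)
  qed
qed

lemma smult_mat_pow:
  fixes A :: "'a :: comm_semiring_1 mat"
  assumes "A \<in> carrier_mat n n"
  shows "(c \<cdot>\<^sub>m A) ^\<^sub>m k = c ^ k \<cdot>\<^sub>m (A ^\<^sub>m k)"
proof (induction k)
  case 0
  show ?case by (rule eq_matI) auto
next
  case (Suc k)
  have Ak: "A ^\<^sub>m k \<in> carrier_mat n n" using assms by simp
  have "(c \<cdot>\<^sub>m A) ^\<^sub>m Suc k = (c ^ k \<cdot>\<^sub>m A ^\<^sub>m k) * (c \<cdot>\<^sub>m A)"
    by (simp only: pow_mat.simps Suc)
  also have "\<dots> = c \<cdot>\<^sub>m ((c ^ k \<cdot>\<^sub>m A ^\<^sub>m k) * A)"
    by (rule mult_smult_distrib[of _ n n _ n]) (use assms Ak in auto)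
  also have "(c ^ k \<cdot>\<^sub>m A ^\<^sub>m k) * A = c ^ k \<cdot>\<^sub>m (A ^\<^sub>m k * A)"
    by (rule mult_smult_assoc_mat[OF Ak assms])
  also have "c \<cdot>\<^sub>m (c ^ k \<cdot>\<^sub>m (A ^\<^sub>m k * A)) = c ^ Suc k \<cdot>\<^sub>m (A ^\<^sub>m Suc k)"
    by (rule eq_matI) (simp_all only: index_smult_mat pow_mat.simps power_Suc mult.assoc)
  finally show ?case .
qed

lemma spectrum_smult_mat:
  fixes A :: "'a :: field mat"
  assumes A: "A \<in> carrier_mat n n" and "c \<noteq> 0"
  shows "spectrum (c \<cdot>\<^sub>m A) = (*) c ` spectrum A"
proof -
  have scale: "eigenvalue (d \<cdot>\<^sub>m X) (d * k)" if ev: "eigenvalue X k" and X: "X \<in> carrier_mat n n" for d k and X :: "'a mat"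
  proof -
    obtain v where v: "v \<in> carrier_vec n" "v \<noteq> 0\<^sub>v n" "X *\<^sub>v v = k \<cdot>\<^sub>v v"
      using ev carrier_matD(1)[OF X] by (auto simp: eigenvalue_def eigenvector_def)
    have "(d \<cdot>\<^sub>m X) *\<^sub>v v = d \<cdot>\<^sub>v (X *\<^sub>v v)"
      using X v(1) by (intro eq_vecI) auto
    then show ?thesis
      using v X unfolding eigenvalue_def eigenvector_def
      by (intro exI[of _ v]) (simp add: smult_smult_assoc)
  qed
  have "k \<in> (*) c ` spectrum A" if "eigenvalue (c \<cdot>\<^sub>m A) k" for k
  proof
    show "k = c * (inverse c * k)" using \<open>c \<noteq> 0\<close> by simp
    have "inverse c \<cdot>\<^sub>m (c \<cdot>\<^sub>m A) = A" using \<open>c \<noteq> 0\<close> by (intro eq_matI) auto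
    then show "inverse c * k \<in> spectrum A"
      using scale[OF that, of "inverse c"] A by (simp add: spectrum_def)
  qed
  with scale[OF _ A, of _ c] show ?thesis by (auto simp: spectrum_def)
qed

lemma cnj_mem_spectrum_int_mat:
  assumes "k \<in> spectrum (map_mat complex_of_int (int_mat s B))"
  shows "cnj k \<in> spectrum (map_mat complex_of_int (int_mat s B))"
proof -
  have eq: "map_mat complex_of_int (int_mat s B) = mat s s (\<lambda>(i, j). complex_of_int (B i j))"
    by (auto simp: int_mat_def)
  obtain w where w: "\<exists>i<s. w i \<noteq> 0" "\<And>i. i < s \<Longrightarrow> (\<Sum>j<s. complex_of_int (B i j) * w j) = k * w i"
    using assms unfolding eq spectrum_def mem_Collect_eq eigenvalue_mat_iff by auto
  have "(\<Sum>j<s. complex_of_int (B i j) * cnj (w j)) = cnj k * cnj (w i)" if "i < s" for i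
    using arg_cong[OF w(2)[OF that], of cnj] by simp
  with w(1) show ?thesis
    unfolding eq spectrum_def mem_Collect_eq eigenvalue_mat_iff
    by (intro exI[of _ "\<lambda>i. cnj (w i)"]) auto
qed

text \<open>Multiplying the matrix by a positive number changes neither the signs of the moments nor
  the spectral conditions, so the matrix can be replaced by an integer one. A unique dominant
  eigenvalue is real, since its conjugate is an eigenvalue of the same modulus.\<close>

lemma moments_nonneg_iff_bounded:
  assumes A: "A \<in> carrier_mat s s"
    and cond: "unique_dominant_eigenvalue A \<or> only_real_eigenvalues A"
  defines "B \<equiv> cleared_entry s (mat_encode A)"
  shows "moments_nonneg A \<longleftrightarrow> (\<forall>n<moment_threshold s B + 2. 0 \<le> mat_trace (int_mat s B ^\<^sub>m n))"
proof -
  obtain D :: nat where D: "0 < D"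
    and entries: "\<And>i j. i < s \<Longrightarrow> j < s \<Longrightarrow> rat_of_int (B i j) = of_nat D * A $$ (i, j)"
    using cleared_entry_mat_encode[OF A] unfolding B_def by metis
  have B: "int_mat s B \<in> carrier_mat s s" by (simp add: int_mat_def)
  have BA: "map_mat rat_of_int (int_mat s B) = of_nat D \<cdot>\<^sub>m A"
    using A by (intro eq_matI) (auto simp: int_mat_def entries)
  have trace: "rat_of_int (mat_trace (int_mat s B ^\<^sub>m n)) = of_nat D ^ n * mat_trace (A ^\<^sub>m n)" for n
  proof -
    have "rat_of_int (mat_trace (int_mat s B ^\<^sub>m n)) = mat_trace (map_mat rat_of_int (int_mat s B ^\<^sub>m n))"
      using B by (simp add: mat_trace_def)
    also have "map_mat rat_of_int (int_mat s B ^\<^sub>m n) = of_nat D ^ n \<cdot>\<^sub>m (A ^\<^sub>m n)"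
      unfolding of_int_hom.mat_hom_pow[OF B] BA by (rule smult_mat_pow[OF A])
    also have "mat_trace \<dots> = of_nat D ^ n * mat_trace (A ^\<^sub>m n)"
      using A by (simp add: mat_trace_def sum_distrib_left)
    finally show ?thesis .
  qed
  have nonneg_iff: "0 \<le> mat_trace (A ^\<^sub>m n) \<longleftrightarrow> 0 \<le> mat_trace (int_mat s B ^\<^sub>m n)" for n
  proof -
    have "0 \<le> mat_trace (int_mat s B ^\<^sub>m n) \<longleftrightarrow> 0 \<le> rat_of_int (mat_trace (int_mat s B ^\<^sub>m n))" by simp
    also have "\<dots> \<longleftrightarrow> 0 \<le> mat_trace (A ^\<^sub>m n)"
      unfolding trace using mult_le_cancel_left_pos[of "rat_of_nat D ^ n" 0] D by simp
    finally show ?thesis by simp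
  qed
  define C where "C = map_mat complex_of_int (int_mat s B)"
  have "C = of_nat D \<cdot>\<^sub>m map_mat of_rat A"
  proof (rule eq_matI)
    fix i j assume "i < dim_row (of_nat D \<cdot>\<^sub>m map_mat of_rat A :: complex mat)"
      "j < dim_col (of_nat D \<cdot>\<^sub>m map_mat of_rat A :: complex mat)"
    then have ij: "i < s" "j < s" using A by auto
    have "complex_of_int (B i j) = of_rat (rat_of_int (B i j))" by simp
    also have "\<dots> = of_nat D * of_rat (A $$ (i, j))" by (simp add: entries[OF ij] of_rat_mult)
    finally show "C $$ (i, j) = (of_nat D \<cdot>\<^sub>m map_mat of_rat A) $$ (i, j)"
      using ij A by (simp add: C_def int_mat_def)
  qed (use A in \<open>auto simp: C_def int_mat_def\<close>)
  then have spec: "spectrum C = (*) (of_nat D) ` complex_spectrum A"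
    using spectrum_smult_mat[of "map_mat of_rat A" s "of_nat D :: complex"] A D
    by (simp add: complex_spectrum_def)
  have "(\<exists>l\<in>spectrum C. l \<in> \<real> \<and> (\<forall>m\<in>spectrum C. m \<noteq> l \<longrightarrow> norm m < norm l)) \<or> spectrum C \<subseteq> \<real>"
    using cond
  proof
    assume "unique_dominant_eigenvalue A"
    then obtain l where l: "l \<in> complex_spectrum A" "\<And>m. m \<in> complex_spectrum A \<Longrightarrow> norm m \<le> norm l"
      and uniq: "\<And>k. k \<in> complex_spectrum A \<Longrightarrow> (\<And>m. m \<in> complex_spectrum A \<Longrightarrow> norm m \<le> norm k) \<Longrightarrow> k = l"
      unfolding unique_dominant_eigenvalue_def by blast
    have uniq': "k = l" if "k \<in> complex_spectrum A" "norm l \<le> norm k" for k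
      using uniq[OF that(1)] l(2) that(2) by force
    have D_l: "complex_of_nat D * l \<in> spectrum C" unfolding spec by (rule imageI[OF l(1)])
    from D_l have "cnj (complex_of_nat D * l) \<in> spectrum C"
      unfolding C_def by (rule cnj_mem_spectrum_int_mat)
    then have "cnj l \<in> complex_spectrum A" using D by (auto simp: spec)
    then have "cnj l = l" by (rule uniq') simp
    then have "l \<in> \<real>" by (simp add: Reals_cnj_iff)
    moreover have "norm m < norm l" if "m \<in> complex_spectrum A" "m \<noteq> l" for m
      using uniq'[OF that(1)] that(2) by force
    ultimately have "complex_of_nat D * l \<in> \<real> \<and>
        (\<forall>m\<in>spectrum C. m \<noteq> of_nat D * l \<longrightarrow> norm m < norm (of_nat D * l))"
      using D by (auto simp: spec norm_mult)
    with D_l show ?thesis by blast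
  next
    assume "only_real_eigenvalues A"
    then show ?thesis unfolding only_real_eigenvalues_def spec by auto
  qed
  then have "0 \<le> mat_trace (int_mat s B ^\<^sub>m (n + 2))"
    if "moment_threshold s B \<le> n" "0 \<le> mat_trace (int_mat s B ^\<^sub>m n)" for n
    unfolding C_def using that by (rule moment_step)
  from all_nonneg_iff_bounded[of "moment_threshold s B" "\<lambda>n. mat_trace (int_mat s B ^\<^sub>m n)", OF this]
  show ?thesis unfolding moments_nonneg_def nonneg_iff by simp
qed

section \<open>The decision procedure\<close>

text \<open>The size \<open>s\<close> is a constant of the procedure, so sums and products over indices are fixed
  finite compositions.\<close>

lemma computable_int_cleared_entry:
  assumes "computable k E"
  shows "computable_int k (\<lambda>xs. cleared_entry s (E xs) i j)"
  unfolding cleared_entry_def split_beta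
  by (intro computable_int_mult computable_int_prod computable_int_decode computable_int_of_nat
      computable_prod_decode computable_code_entry assms)

lemma computable_moment_threshold:
  assumes "computable k E"
  shows "computable k (\<lambda>xs. moment_threshold s (cleared_entry s (E xs)))"
proof -
  have "nat \<bar>z\<bar> = nat z + nat (- z)" for z by simp
  then have "computable k (\<lambda>xs. entry_bound s (cleared_entry s (E xs)))"
    unfolding entry_bound_def
    by (simp only:) (intro computable_arith computable_sum computable_int_nat_parts
        computable_int_cleared_entry assms)
  then show ?thesis
    unfolding moment_threshold_def by (intro computable_arith computable_power)
qed

text \<open>Encoding all entries of the power in one number turns their simultaneous recursion in \<open>n\<close> into
  an ordinary primitive recursion.\<close>

definition power_code :: "nat \<Rightarrow> nat \<Rightarrow> nat \<Rightarrow> nat" where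
  "power_code s e n =
    encode_square s (\<lambda>i j. int_encode ((int_mat s (cleared_entry s e) ^\<^sub>m n) $$ (i, j)))"

lemma encode_square_cong:
  "(\<And>i j. i < s \<Longrightarrow> j < s \<Longrightarrow> f i j = g i j) \<Longrightarrow> encode_square s f = encode_square s g"
  unfolding encode_square_def by (intro arg_cong[of _ _ list_encode] map_cong refl) auto

lemma power_code_rec:
  "power_code s e n = rec_nat (encode_square s (\<lambda>i j. int_encode (if i = j then 1 else 0)))
    (\<lambda>n r. encode_square s (\<lambda>i j.
      int_encode (\<Sum>k<s. int_decode (code_entry r i k) * cleared_entry s e k j))) n"
proof (induction n)
  case 0
  show ?case by (auto simp: power_code_def int_mat_def intro!: encode_square_cong)
next
  case (Suc n)
  let ?B = "int_mat s (cleared_entry s e)"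
  have B: "?B \<in> carrier_mat s s" by (simp add: int_mat_def)
  have "power_code s e (Suc n) = encode_square s (\<lambda>i j.
      int_encode (\<Sum>k<s. int_decode (code_entry (power_code s e n) i k) * cleared_entry s e k j))"
    unfolding power_code_def[of s e "Suc n"]
  proof (rule encode_square_cong)
    fix i j assume ij: "i < s" "j < s"
    have "(?B ^\<^sub>m Suc n) $$ (i, j) = (\<Sum>k<s. (?B ^\<^sub>m n) $$ (i, k) * ?B $$ (k, j))"
      using ij B by (auto simp: scalar_prod_def lessThan_atLeast0 intro!: sum.cong)
    also have "\<dots> = (\<Sum>k<s. int_decode (code_entry (power_code s e n) i k) * cleared_entry s e k j)"
      using ij by (intro sum.cong) (auto simp: power_code_def code_entry_encode_square int_mat_def)
    finally show "int_encode ((?B ^\<^sub>m Suc n) $$ (i, j)) =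
      int_encode (\<Sum>k<s. int_decode (code_entry (power_code s e n) i k) * cleared_entry s e k j)"
      by simp
  qed
  then show ?case by (simp add: Suc)
qed

lemma computable_power_code:
  assumes E: "computable k E" and N: "computable k N"
  shows "computable k (\<lambda>xs. power_code s (E xs) (N xs))"
proof -
  let ?G = "\<lambda>ys. encode_square s (\<lambda>i j. int_encode (\<Sum>l<s. int_decode (code_entry (ys ! 1) i l) *
      cleared_entry s (E (drop 2 ys)) l j))"
  have "computable (Suc (Suc k)) ?G"
  proof (rule computable_encode_square)
    fix i j
    have "computable_int (Suc (Suc k)) (\<lambda>ys. \<Sum>l<s. int_decode (code_entry (ys ! 1) i l) *
        cleared_entry s (E (drop 2 ys)) l j)"
      by (intro computable_int_sum computable_int_mult computable_int_decode computable_code_entry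
          computable_int_cleared_entry computable_proj computable_drop[OF E]) simp_all
    then show "computable (Suc (Suc k)) (\<lambda>ys. int_encode (\<Sum>l<s. int_decode (code_entry (ys ! 1) i l) *
        cleared_entry s (E (drop 2 ys)) l j))"
      by (simp only: computable_int_def)
  qed
  from computable_rec[OF computable_const this N] show ?thesis
    by (simp add: power_code_rec)
qed

lemma computable_int_moment:
  assumes "computable k E" "computable k N"
  shows "computable_int k (\<lambda>xs. mat_trace (int_mat s (cleared_entry s (E xs)) ^\<^sub>m N xs))"
proof -
  have "mat_trace (int_mat s (cleared_entry s e) ^\<^sub>m n) =
      (\<Sum>i<s. int_decode (code_entry (power_code s e n) i i))" for e n
    by (simp add: mat_trace_def power_code_def code_entry_encode_square) (simp add: int_mat_def)
  then show ?thesis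
    by (simp only:) (intro computable_int_sum computable_int_decode computable_code_entry
        computable_power_code assms)
qed

text \<open>One procedure serves both spectral conditions: it tests the moments up to the threshold and one
  step past it, for the two parities of the exponent, and nothing in it depends on which of the conditions holds.\<close>

lemma moments_nonneg_decidable_on:
  assumes "\<And>A. A \<in> I \<Longrightarrow> A \<in> carrier_mat s s \<and> (unique_dominant_eigenvalue A \<or> only_real_eigenvalues A)"
  shows "decidable_on mat_encode I moments_nonneg"
proof -
  let ?B = "\<lambda>e. cleared_entry s e"
  let ?N = "\<lambda>xs. moment_threshold s (?B (xs ! 0)) + 2"
  let ?F = "\<lambda>n xs. mat_trace (int_mat s (?B (xs ! 0)) ^\<^sub>m n)"
  have "computable_int (Suc 1) (\<lambda>ys. mat_trace (int_mat s (?B (ys ! 1)) ^\<^sub>m (ys ! 0)))"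
    by (intro computable_int_moment computable_proj) auto
  then have "computable_int (Suc 1) (\<lambda>ys. ?F (hd ys) (tl ys))"
    unfolding computable_int_def by (rule computable_cong) (auto simp: length_Suc_conv)
  moreover have "computable 1 ?N"
    by (intro computable_add computable_moment_threshold computable_proj computable_const) simp
  ultimately have "computable 1 (\<lambda>xs. if \<forall>n<?N xs. 0 \<le> ?F n xs then 1 else 0)"
    by (intro computable_bounded_nonneg)
  then obtain f where f: "\<And>xs. length xs = 1 \<Longrightarrow> rec_eval f xs (if \<forall>n<?N xs. 0 \<le> ?F n xs then 1 else 0)"
    unfolding computable_def by blast
  have "rec_eval f [mat_encode A] (if moments_nonneg A then 1 else 0)" if "A \<in> I" for A
    using f[of "[mat_encode A]"] moments_nonneg_iff_bounded[of A s] assms[OF that] by simp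
  then show ?thesis unfolding decidable_on_def by blast
qed

theorem theorem13:
  fixes s :: nat
  assumes "1 \<le> s"
  shows "decidable_on mat_encode {A \<in> carrier_mat s s. unique_dominant_eigenvalue A} moments_nonneg
    \<and> decidable_on mat_encode {A \<in> carrier_mat s s. only_real_eigenvalues A} moments_nonneg"
  by (intro conjI moments_nonneg_decidable_on) auto

end
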